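(* There exists a real sequence $\delta=(\delta_1,\delta_2,\ldots)\in\ell^2$ with $\|\delta\|\le 0.13$ such that, for every $k=1,2,\ldots$, $$\sum_{n=1}^{\infty} \int_0^{\delta_n} \cos (\pi y) \Big(\frac{1}{n+\frac{1}{2}-y-k}+\frac{1}{n+\frac{1}{2}-y+k}\Big)\,dy=\frac{1}{\pi}\int_{-\frac{1}{2}}^{\frac{1}{2}} \frac{\cos (\pi x)}{(x-k)^2}\, dx .$$
   Context: $\|\cdot\|$ denotes the $\ell^2$ norm of sequences indexed by the positive integers. *)

theory Defs
  imports "HOL-Analysis.Analysis"
begin

text \<open>
  Sequences indexed by the positive integers are functions \<open>\<delta> :: nat \<Rightarrow> real\<close> whose value at \<open>0\<close>
  is ignored; sums over \<open>n \<ge> 1\<close> are series over all naturals with \<open>n\<close> replaced by \<open>Suc n\<close>.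
\<close>

definition in_l2 :: "(nat \<Rightarrow> real) \<Rightarrow> bool" where
  "in_l2 \<delta> \<longleftrightarrow> summable (\<lambda>n. (\<delta> (Suc n))\<^sup>2)"

definition l2_norm :: "(nat \<Rightarrow> real) \<Rightarrow> real" where
  "l2_norm \<delta> = sqrt (\<Sum>n. (\<delta> (Suc n))\<^sup>2)"

end

theory Submission
  imports Defs
begin

text \<open>
  Put \<open>s\<^sub>n = sin (\<pi> \<delta>\<^sub>n) / \<pi>\<close> and \<open>\<nu> = n + 1/2\<close>. The system becomes \<open>A s + R(\<delta>) = b\<close>, where \<open>A\<close> is the matrix
  \<open>1/(\<nu> - k) + 1/(\<nu> + k)\<close> with \<open>\<nu> \<ge> 3/2\<close>, \<open>k \<ge> 1\<close>, and \<open>R\<close> is quadratically small. On odd sequences over all half-integers the matrix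
  \<open>1/(\<nu> - k)\<close> is \<open>\<pi>\<close> times an isometry onto the even sequences over the integers. Dropping the unknown at
  \<open>\<nu> = 1/2\<close> is compensated by dropping the equation at \<open>k = 0\<close>, which makes \<open>A\<close> invertible with an explicit inverse \<open>M\<close> of
  norm \<open>1 / sqrt 8\<close>. Numerically \<open>\<parallel>b\<parallel> \<le> 0.273\<close> and \<open>\<parallel>R(\<delta>)\<parallel> \<le> 0.0737\<close> for \<open>\<parallel>\<delta>\<parallel> \<le> 0.13\<close>, so that
  \<open>\<delta> \<mapsto> arcsin (\<pi> M (b - R(\<delta>))) / \<pi>\<close> is a contraction of the ball of radius \<open>0.13\<close>.
\<close>

section \<open>Square-summable sequences\<close>

text \<open>Bounding every finite section says at once that the sequence lies in l2 and that its
  norm is at most \<open>c\<close>, with no separate summability condition.\<close>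

definition l2_le :: "(nat \<Rightarrow> real) \<Rightarrow> real \<Rightarrow> bool" where
  "l2_le f c \<longleftrightarrow> (\<forall>N. L2_set f {..<N} \<le> c)"

lemma l2_leD: "l2_le f c \<Longrightarrow> L2_set f {..<N} \<le> c"
  by (simp add: l2_le_def)

lemma l2_le_nonneg: "l2_le f c \<Longrightarrow> 0 \<le> c"
  using l2_leD[of f c 0] by simp

lemma l2_le_mono: "l2_le f c \<Longrightarrow> c \<le> d \<Longrightarrow> l2_le f d"
  by (auto simp: l2_le_def intro: order_trans)

lemma l2_le_zero: "l2_le (\<lambda>n. 0) 0"
  by (simp add: l2_le_def L2_set_def)

lemma l2_le_iff_sum_sq:
  assumes "0 \<le> c"
  shows "l2_le f c \<longleftrightarrow> (\<forall>N. (\<Sum>n<N. (f n)\<^sup>2) \<le> c\<^sup>2)"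
proof -
  have "L2_set f {..<N} \<le> c \<longleftrightarrow> (\<Sum>n<N. (f n)\<^sup>2) \<le> c\<^sup>2" for N
    unfolding L2_set_def using assms sum_nonneg[of "{..<N}" "\<lambda>n. (f n)\<^sup>2"]
    by (metis real_sqrt_le_iff real_sqrt_pow2 real_sqrt_abs abs_of_nonneg)
  then show ?thesis by (simp add: l2_le_def)
qed

lemma l2_le_add: "l2_le f a \<Longrightarrow> l2_le g b \<Longrightarrow> l2_le (\<lambda>n. f n + g n) (a + b)"
  unfolding l2_le_def using L2_set_triangle_ineq[of f g] by (smt (verit))

lemma l2_le_dominated:
  assumes "l2_le g a" "0 \<le> c" "\<And>n. \<bar>f n\<bar> \<le> c * \<bar>g n\<bar>"
  shows "l2_le f (c * a)"
  unfolding l2_le_def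
proof
  fix N
  have "L2_set f {..<N} = L2_set (\<lambda>n. \<bar>f n\<bar>) {..<N}"
    by (simp add: L2_set_def)
  also have "\<dots> \<le> L2_set (\<lambda>n. c * \<bar>g n\<bar>) {..<N}"
    by (intro L2_set_mono assms) auto
  also have "\<dots> = c * L2_set (\<lambda>n. \<bar>g n\<bar>) {..<N}"
    using assms(2) by (simp add: L2_set_right_distrib)
  also have "\<dots> = c * L2_set g {..<N}"
    by (simp add: L2_set_def)
  also have "\<dots> \<le> c * a"
    by (intro mult_left_mono l2_leD assms)
  finally show "L2_set f {..<N} \<le> c * a" .
qed

lemma l2_le_diff:
  assumes "l2_le f a" "l2_le g b" shows "l2_le (\<lambda>n. f n - g n) (a + b)"
  using l2_le_add[OF assms(1) l2_le_dominated[OF assms(2), of 1 "\<lambda>n. - g n"]] by simp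

lemma l2_le_component:
  assumes "l2_le f c" shows "\<bar>f n\<bar> \<le> c"
proof -
  have "\<bar>f n\<bar> \<le> L2_set (\<lambda>n. \<bar>f n\<bar>) {..<Suc n}"
    by (rule member_le_L2_set) auto
  also have "\<dots> = L2_set f {..<Suc n}" by (simp add: L2_set_def)
  finally show ?thesis using l2_leD[OF assms, of "Suc n"] by linarith
qed

text \<open>A finite section depends continuously on finitely many coordinates, so coordinatewise
  convergence already preserves the norm bound, as in Fatou's lemma.\<close>

lemma l2_le_limit:
  assumes "\<And>n. (\<lambda>m. f m n) \<longlonglongrightarrow> g n" "eventually (\<lambda>m. l2_le (f m) c) sequentially"
  shows "l2_le g c"
  unfolding l2_le_def
proof
  fix N
  have "(\<lambda>m. L2_set (f m) {..<N}) \<longlonglongrightarrow> L2_set g {..<N}"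
    unfolding L2_set_def by (intro tendsto_intros assms)
  then show "L2_set g {..<N} \<le> c"
    by (rule tendsto_upperbound) (use assms(2) in \<open>auto elim: eventually_mono simp: l2_le_def\<close>)
qed

text \<open>Cauchy-Schwarz on finite sections, uniformly in their length.\<close>

lemma l2_le_mult:
  assumes "l2_le f a" "l2_le g b"
  shows "summable (\<lambda>n. \<bar>f n * g n\<bar>)" "(\<Sum>n. \<bar>f n * g n\<bar>) \<le> a * b"
proof -
  have *: "(\<Sum>n<N. \<bar>f n * g n\<bar>) \<le> a * b" for N
  proof -
    have "(\<Sum>n<N. \<bar>f n * g n\<bar>) \<le> L2_set f {..<N} * L2_set g {..<N}"
      using L2_set_mult_ineq[of f g "{..<N}"] by (simp add: abs_mult)
    also have "\<dots> \<le> a * b"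
      by (intro mult_mono l2_leD assms l2_le_nonneg[OF assms(1)]) auto
    finally show ?thesis .
  qed
  show S: "summable (\<lambda>n. \<bar>f n * g n\<bar>)"
    by (rule summableI_nonneg_bounded[OF _ *]) auto
  show "(\<Sum>n. \<bar>f n * g n\<bar>) \<le> a * b"
    by (rule suminf_le_const[OF S *])
qed

lemma l2_le_of_sums_sq:
  assumes "(\<lambda>n. (f n)\<^sup>2) sums s" shows "l2_le f (sqrt s)"
proof -
  have "0 \<le> s" using assms by (metis sums_le[OF _ sums_zero] zero_le_power2)
  moreover have "(\<Sum>n<N. (f n)\<^sup>2) \<le> s" for N
    using sum_le_suminf[OF sums_summable[OF assms], of "{..<N}"] sums_unique[OF assms] by simp
  ultimately show ?thesis by (simp add: l2_le_iff_sum_sq)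
qed

lemma l2_le_summable_sq:
  assumes "l2_le f c"
  shows "summable (\<lambda>n. (f n)\<^sup>2)" "(\<Sum>n. (f n)\<^sup>2) \<le> c\<^sup>2"
  using l2_le_mult[OF assms assms] by (simp_all add: power2_eq_square)

lemma l2_le_tail:
  assumes "l2_le f c" "e > 0"
  obtains J where "\<And>i. i \<ge> J \<Longrightarrow> l2_le (\<lambda>n. if n < i then 0 else f n) e"
proof -
  have S: "summable (\<lambda>n. (f n)\<^sup>2)" by (rule l2_le_summable_sq[OF assms(1)])
  have "(\<lambda>i. \<Sum>n. (f (n + i))\<^sup>2) \<longlonglongrightarrow> 0"
    by (rule suminf_exist_split2[OF S])
  then have "eventually (\<lambda>i. (\<Sum>n. (f (n + i))\<^sup>2) < e\<^sup>2) sequentially"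
    by (rule order_tendstoD) (use assms in auto)
  then obtain J where J: "\<And>i. i \<ge> J \<Longrightarrow> (\<Sum>n. (f (n + i))\<^sup>2) < e\<^sup>2"
    by (auto simp: eventually_sequentially)
  have "l2_le (\<lambda>n. if n < i then 0 else f n) e" if "i \<ge> J" for i
  proof -
    have "(\<Sum>n<N. (if n < i then 0 else f n)\<^sup>2) \<le> e\<^sup>2" for N
    proof -
      have "(\<Sum>n<N. (if n < i then 0 else f n)\<^sup>2) \<le> (\<Sum>n<N+i. (if n < i then 0 else f n)\<^sup>2)"
        by (intro sum_mono2) auto
      also have "\<dots> = (\<Sum>n\<in>{0..<i}. (if n < i then 0 else f n)\<^sup>2) + (\<Sum>n\<in>{i..<N+i}. (if n < i then 0 else f n)\<^sup>2)"
        by (subst sum.atLeastLessThan_concat) (auto simp: lessThan_atLeast0)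
      also have "(\<Sum>n\<in>{0..<i}. (if n < i then 0 else f n)\<^sup>2) = 0"
        by (intro sum.neutral) auto
      also have "(\<Sum>n\<in>{i..<N+i}. (if n < i then 0 else f n)\<^sup>2) = (\<Sum>n\<in>{0..<N}. (f (n + i))\<^sup>2)"
        using sum.shift_bounds_nat_ivl[of "\<lambda>n. (if n < i then 0 else f n)\<^sup>2" 0 i N] by simp
      also have "0 + \<dots> \<le> (\<Sum>n. (f (n + i))\<^sup>2)"
        using S by (simp add: sum_le_suminf summable_iff_shift[of "\<lambda>n. (f n)\<^sup>2"])
      finally show ?thesis using J[OF that] by linarith
    qed
    then show ?thesis using assms(2) by (simp add: l2_le_iff_sum_sq)
  qed
  then show thesis by (rule that)
qed

text \<open>Banach's fixed point theorem on a ball of l2 with factor \<open>1/2\<close>. The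
  iterates from zero converge coordinatewise, and \<open>l2_le_limit\<close> carries the norm
  estimates over to the limit, which replaces completeness of l2.\<close>

lemma l2_contraction_fixpoint:
  fixes T :: "(nat \<Rightarrow> real) \<Rightarrow> nat \<Rightarrow> real"
  assumes self: "\<And>x. l2_le x r \<Longrightarrow> l2_le (T x) r"
    and contr: "\<And>x y c. l2_le x r \<Longrightarrow> l2_le y r \<Longrightarrow> l2_le (\<lambda>n. x n - y n) c \<Longrightarrow>
                  l2_le (\<lambda>n. T x n - T y n) (c / 2)"
    and "0 \<le> r"
  obtains x where "l2_le x r" "T x = x"
proof -
  define X where "X m = (T ^^ m) (\<lambda>n. 0)" for m
  have X: "l2_le (X m) r" for m
    by (induction m) (auto simp: X_def self intro: l2_le_mono[OF l2_le_zero assms(3)])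
  have step: "l2_le (\<lambda>n. X (Suc m) n - X m n) (2 * r / 2 ^ m)" for m
  proof (induction m)
    case 0
    show ?case using l2_le_diff[OF X[of 1] X[of 0]] by simp
  next
    case (Suc m)
    from contr[OF X X this] show ?case by (simp add: X_def)
  qed
  have dist: "l2_le (\<lambda>n. X (m + j) n - X m n) (4 * r / 2 ^ m)" for m j
  proof -
    \<comment> \<open>Subtracting the rest of the geometric series makes the bound inductive in
      \<open>j\<close>.\<close>
    have "l2_le (\<lambda>n. X (m + j) n - X m n) (4 * r / 2 ^ m - 4 * r / 2 ^ (m + j))"
    proof (induction j)
      case 0
      show ?case using l2_le_zero by simp
    next
      case (Suc j)
      have "(2 * r / 2 ^ (m + j)) + (4 * r / 2 ^ m - 4 * r / 2 ^ (m + j)) = 4 * r / 2 ^ m - 4 * r / 2 ^ (m + Suc j)"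
        by (simp add: field_simps)
      then show ?case using l2_le_add[OF step[of "m + j"] Suc] by simp
    qed
    then show ?thesis by (rule l2_le_mono) (use assms(3) in simp)
  qed
  have "\<exists>l. (\<lambda>m. X m n) \<longlonglongrightarrow> l" for n
  proof -
    have "summable (\<lambda>m. X (Suc m) n - X m n)"
    proof (rule summable_comparison_test')
      show "summable (\<lambda>m. 2 * r * (1 / 2) ^ m)"
        by (intro summable_mult summable_geometric) simp
      show "norm (X (Suc m) n - X m n) \<le> 2 * r * (1 / 2) ^ m" for m
        using l2_le_component[OF step, of m n] by (simp add: power_divide)
    qed
    then have "convergent (\<lambda>N. \<Sum>m<N. X (Suc m) n - X m n)"
      by (simp add: summable_iff_convergent)
    then have "convergent (\<lambda>N. X N n - X 0 n)"
      by (simp add: sum_lessThan_telescope[of "\<lambda>m. X m n"])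
    then show ?thesis
      using convergent_add[OF _ convergent_const[of "X 0 n"]] by (fastforce simp: convergent_def)
  qed
  then obtain x where lim: "\<And>n. (\<lambda>m. X m n) \<longlonglongrightarrow> x n" by metis
  have x: "l2_le x r"
    by (rule l2_le_limit[OF lim]) (simp add: X)
  have xX: "l2_le (\<lambda>n. x n - X m n) (4 * r / 2 ^ m)" for m
  proof (rule l2_le_limit)
    show "(\<lambda>j. X (m + j) n - X m n) \<longlonglongrightarrow> x n - X m n" for n
      using LIMSEQ_ignore_initial_segment[OF lim, of m n] by (intro tendsto_intros) (simp add: add.commute)
    show "eventually (\<lambda>j. l2_le (\<lambda>n. X (m + j) n - X m n) (4 * r / 2 ^ m)) sequentially"
      by (simp add: dist)
  qed
  \<comment> \<open>The contraction estimate makes \<open>T\<close> continuous at \<open>x\<close>,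
    so the shifted iterates tend both to \<open>T x\<close> and to \<open>x\<close>.\<close>
  have "T x n = x n" for n
  proof (rule LIMSEQ_unique)
    have "(\<lambda>m. T x n - X (Suc m) n) \<longlonglongrightarrow> 0"
    proof (rule Lim_null_comparison)
      show "eventually (\<lambda>m. norm (T x n - X (Suc m) n) \<le> 4 * r / 2 ^ m / 2) sequentially"
      proof (intro always_eventually allI)
        fix m
        show "norm (T x n - X (Suc m) n) \<le> 4 * r / 2 ^ m / 2"
          using l2_le_component[OF contr[OF x X[of m] xX[of m]], of n] by (simp add: X_def)
      qed
      have "(\<lambda>m. 2 * r * (1 / 2) ^ m) \<longlonglongrightarrow> 2 * r * 0"
        by (intro tendsto_intros LIMSEQ_realpow_zero) auto
      then show "(\<lambda>m. 4 * r / 2 ^ m / 2) \<longlonglongrightarrow> 0"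
        by (simp add: power_divide)
    qed
    from tendsto_diff[OF tendsto_const[of "T x n"] this]
    show "(\<lambda>m. X (Suc m) n) \<longlonglongrightarrow> T x n" by simp
    show "(\<lambda>m. X (Suc m) n) \<longlonglongrightarrow> x n" by (rule LIMSEQ_Suc[OF lim])
  qed
  then show thesis using that[OF x] by auto
qed

section \<open>The matrix and its inverse\<close>

text \<open>A matrix entry; \<open>t\<close> will be a half-integer, so no pole is met. It is odd in
  \<open>t\<close>, and \<open>ker 0 t = 2 / t\<close>.\<close>

definition ker :: "nat \<Rightarrow> real \<Rightarrow> real" where
  "ker k t = 1 / (t - real k) + 1 / (t + real k)"

definition beta :: "nat \<Rightarrow> real" where
  "beta k = 2 / (4 * (real k)\<^sup>2 - 1)"

text \<open>The transposed kernel corrected by a multiple of \<open>1 / t\<close>, which is half of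
  \<open>ker 0 t\<close>: a correction along the omitted row \<open>k = 0\<close>.\<close>

definition inv_ker :: "nat \<Rightarrow> real \<Rightarrow> real" where
  "inv_ker k t = (beta k / t + ker k t) / pi\<^sup>2"

section \<open>Explicit series over the half-integers and over the integers\<close>

lemma half_int_neq: "real m + 1/2 \<noteq> real k"
proof -
  have "2 * m + 1 \<noteq> 2 * k" by presburger
  then have "real (2 * m + 1) \<noteq> real (2 * k)"
    unfolding of_nat_eq_iff .
  then show ?thesis by (auto simp: field_simps)
qed

lemma inverse_shift_tendsto_0: "(\<lambda>n. 1 / (real n + c)) \<longlonglongrightarrow> 0"
  by (rule real_tendsto_divide_at_top[OF tendsto_const])
     (subst add.commute, intro filterlim_tendsto_add_at_top[OF tendsto_const] filterlim_real_sequentially)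

text \<open>Passing from \<open>k\<close> to \<open>k + 1\<close> adds two telescoping series whose
  sums \<open>a 0\<close> and \<open>c 0\<close> cancel.\<close>

lemma sums_inverse_sq_diff:
  "(\<lambda>n. 1 / (real n + 1/2 - real k) - 1 / (real n + 1/2 + real k)) sums 0"
proof (induction k)
  case 0
  show ?case by simp
next
  case (Suc k)
  define a where "a n = 1 / (real n + (- 1/2 - real k))" for n
  define c where "c n = 1 / (real n + (1/2 + real k))" for n
  have "(\<lambda>n. a n - a (Suc n)) sums (a 0 - 0)" "(\<lambda>n. c n - c (Suc n)) sums (c 0 - 0)"
    by (intro telescope_sums'; unfold a_def c_def; rule inverse_shift_tendsto_0)+
  from sums_add[OF sums_add[OF this] Suc]
  have "(\<lambda>n. a n - a (Suc n) + (c n - c (Suc n)) +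
      (1 / (real n + 1/2 - real k) - 1 / (real n + 1/2 + real k))) sums (a 0 + c 0)" by simp
  moreover have "a 0 + c 0 = 0"
    by (simp add: a_def c_def divide_simps)
  ultimately show ?case
    by (simp add: a_def c_def algebra_simps)
qed

text \<open>Group the Basel series in pairs; four times the result minus the series itself cancels
  the even squares and leaves the odd ones.\<close>

lemma sums_odd_squares: "(\<lambda>n. 1 / (real n + 1/2)\<^sup>2) sums (pi\<^sup>2 / 2)"
proof -
  have A: "(\<lambda>n. 1 / (real n + 1)\<^sup>2) sums (pi\<^sup>2 / 6)"
    using inverse_squares_sums by (simp add: add.commute)
  have "(\<lambda>n. \<Sum>i\<in>{n * 2..<n * 2 + 2}. 1 / (real i + 1)\<^sup>2) sums (pi\<^sup>2 / 6)"
    by (rule sums_group[OF A]) simp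
  then have "(\<lambda>n. 1 / (2 * real n + 1)\<^sup>2 + 1 / (2 * real n + 2)\<^sup>2) sums (pi\<^sup>2 / 6)"
    by (simp add: numeral_2_eq_2 algebra_simps)
  from sums_diff[OF sums_mult[OF this, of 4] A]
  have "(\<lambda>n. 4 * (1 / (2 * real n + 1)\<^sup>2 + 1 / (2 * real n + 2)\<^sup>2) - 1 / (real n + 1)\<^sup>2) sums (pi\<^sup>2 / 2)"
    by simp
  moreover have "4 * (1 / (2 * real n + 1)\<^sup>2 + 1 / (2 * real n + 2)\<^sup>2) - 1 / (real n + 1)\<^sup>2
     = 1 / (real n + 1/2)\<^sup>2" for n
  proof -
    have "(2 * real n + 1)\<^sup>2 = 4 * (real n + 1/2)\<^sup>2" "(2 * real n + 2)\<^sup>2 = 4 * (real n + 1)\<^sup>2"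
      by (simp_all add: power2_eq_square algebra_simps)
    then show ?thesis by simp
  qed
  ultimately show ?thesis by simp
qed

text \<open>A sum over all half-integers is invariant under integer translation. The induction
  realises one translation as the difference of two telescoping series with equal first
  terms.\<close>

lemma sums_sq_kernel_over_half_integers:
  "(\<lambda>n. 1 / (real n + 1/2 - real k)\<^sup>2 + 1 / (real n + 1/2 + real k)\<^sup>2) sums pi\<^sup>2"
proof (induction k)
  case 0
  show ?case using sums_mult[OF sums_odd_squares, of 2] by simp
next
  case (Suc k)
  define a where "a n = (1 / (real n + (- 1/2 - real k)))\<^sup>2" for n
  define c where "c n = (1 / (real n + (1/2 + real k)))\<^sup>2" for n
  have "a \<longlonglongrightarrow> 0\<^sup>2" "c \<longlonglongrightarrow> 0\<^sup>2"
    unfolding a_def c_def by (intro tendsto_power inverse_shift_tendsto_0)+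
  then have "(\<lambda>n. a n - a (Suc n)) sums (a 0 - 0)" "(\<lambda>n. c n - c (Suc n)) sums (c 0 - 0)"
    by (intro telescope_sums'; simp)+
  from sums_add[OF sums_diff[OF this] Suc]
  have "(\<lambda>n. a n - a (Suc n) - (c n - c (Suc n)) +
      (1 / (real n + 1/2 - real k)\<^sup>2 + 1 / (real n + 1/2 + real k)\<^sup>2)) sums (a 0 - c 0 + pi\<^sup>2)" by simp
  moreover have "a 0 = c 0"
    by (simp add: a_def c_def power_divide power2_eq_square algebra_simps)
  ultimately show ?case
    by (simp add: a_def c_def algebra_simps power_divide)
qed

text \<open>Now the half-integer is fixed and the integer varies. The sum over all integers is
  \<open>pi\<^sup>2\<close>; the series omits the integer 0, whose term is subtracted on the
  right.\<close>

lemma sums_sq_kernel_over_integers: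
  "(\<lambda>k. 1 / (real n + 1/2 - real (Suc k))\<^sup>2 + 1 / (real n + 1/2 + real (Suc k))\<^sup>2)
     sums (pi\<^sup>2 - 1 / (real n + 1/2)\<^sup>2)"
proof (induction n)
  case 0
  have "(\<lambda>n. 1 / (real (Suc n) + 1/2)\<^sup>2) sums (pi\<^sup>2 / 2 - 4)"
    using sums_odd_squares by (subst sums_Suc_iff) (simp add: power_divide)
  have *: "(- real k - 1 / 2)\<^sup>2 = (real k + 1 / 2)\<^sup>2" for k
    by (simp add: power2_eq_square algebra_simps)
  from sums_add[OF sums_odd_squares \<open>_ sums (pi\<^sup>2 / 2 - 4)\<close>] show ?case
    by (simp add: power_divide algebra_simps *)
next
  case (Suc n)
  define a where "a k = (1 / (real k + (- 1/2 - real n)))\<^sup>2" for k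
  define c where "c k = (1 / (real k + (3/2 + real n)))\<^sup>2" for k
  have "a \<longlonglongrightarrow> 0\<^sup>2" "c \<longlonglongrightarrow> 0\<^sup>2"
    unfolding a_def c_def by (intro tendsto_power inverse_shift_tendsto_0)+
  then have "(\<lambda>k. a k - a (Suc k)) sums (a 0 - 0)" "(\<lambda>k. c k - c (Suc k)) sums (c 0 - 0)"
    by (intro telescope_sums'; simp)+
  from sums_add[OF sums_diff[OF this] Suc]
  have "(\<lambda>k. a k - a (Suc k) - (c k - c (Suc k)) +
      (1 / (real n + 1/2 - real (Suc k))\<^sup>2 + 1 / (real n + 1/2 + real (Suc k))\<^sup>2))
        sums (a 0 - c 0 + (pi\<^sup>2 - 1 / (real n + 1/2)\<^sup>2))" by simp
  moreover have "a k - a (Suc k) - (c k - c (Suc k)) +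
      (1 / (real n + 1/2 - real (Suc k))\<^sup>2 + 1 / (real n + 1/2 + real (Suc k))\<^sup>2) = 
      1 / (real (Suc n) + 1/2 - real (Suc k))\<^sup>2 + 1 / (real (Suc n) + 1/2 + real (Suc k))\<^sup>2" for k
  proof -
    have "(real k + (- 1/2 - real n))\<^sup>2 = (real (Suc n) + 1/2 - real (Suc k))\<^sup>2"
      "(real (Suc k) + (- 1/2 - real n))\<^sup>2 = (real n + 1/2 - real (Suc k))\<^sup>2"
      by (simp_all add: power2_eq_square algebra_simps)
    then show ?thesis by (simp add: a_def c_def power_divide algebra_simps)
  qed
  moreover have "a 0 = 1 / (real n + 1/2)\<^sup>2" "c 0 = 1 / (real (Suc n) + 1/2)\<^sup>2"
    by (simp_all add: a_def c_def power_divide power2_eq_square algebra_simps)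
  ultimately show ?case by simp
qed

text \<open>Passes from all positive half-integers to those with an unknown, which start at
  \<open>3/2\<close>.\<close>

lemma sums_half_shift:
  fixes f :: "real \<Rightarrow> real"
  assumes "(\<lambda>n. f (real n + 1/2)) sums s" "f (1/2) = 0"
  shows "(\<lambda>n. f (real n + 3/2)) sums s"
proof -
  have "(\<lambda>n. f (real (Suc n) + 1/2)) sums s"
    using assms sums_Suc_iff[of "\<lambda>n. f (real n + 1/2)" s] by simp
  moreover have "real (Suc n) + 1/2 = real n + 3/2" for n by simp
  ultimately show ?thesis by (simp only:)
qed

lemma half_int_nonzero:
  "real n + 1/2 - real k \<noteq> 0" "real n + 1/2 + real k \<noteq> 0" "(real n + 1/2)\<^sup>2 - (real k)\<^sup>2 \<noteq> 0"
proof -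
  show 1: "real n + 1/2 - real k \<noteq> 0" using half_int_neq[of n k] by linarith
  show 2: "real n + 1/2 + real k \<noteq> 0" by linarith
  have "(real n + 1/2)\<^sup>2 - (real k)\<^sup>2 = (real n + 1/2 - real k) * (real n + 1/2 + real k)"
    by (simp add: power2_eq_square algebra_simps)
  then show "(real n + 1/2)\<^sup>2 - (real k)\<^sup>2 \<noteq> 0"
    using 1 2 by (metis mult_eq_0_iff)
qed

section \<open>Orthogonality of the rows and the Gram matrix of the inverse\<close>

lemma ker_eq:
  assumes "t - real k \<noteq> 0" "t + real k \<noteq> 0"
  shows "ker k t = 2 * t / (t\<^sup>2 - (real k)\<^sup>2)"
    and "1 / (t - real k) - 1 / (t + real k) = 2 * real k / (t\<^sup>2 - (real k)\<^sup>2)"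
proof -
  have e: "t\<^sup>2 - (real k)\<^sup>2 = (t - real k) * (t + real k)"
    by (simp add: power2_eq_square algebra_simps)
  show "ker k t = 2 * t / (t\<^sup>2 - (real k)\<^sup>2)"
    unfolding ker_def e using add_frac_eq[OF assms, of 1 1] by simp
  show "1 / (t - real k) - 1 / (t + real k) = 2 * real k / (t\<^sup>2 - (real k)\<^sup>2)"
    unfolding e using diff_frac_eq[OF assms, of 1 1] by simp
qed

lemma sums_inverse_sq_diff':
  "k \<ge> 1 \<Longrightarrow> (\<lambda>n. 1 / ((real n + 1/2)\<^sup>2 - (real k)\<^sup>2)) sums 0"
  using sums_mult[OF sums_inverse_sq_diff[of k], of "1 / (2 * real k)"] half_int_nonzero
  by (simp add: ker_eq(2))

text \<open>Rows are orthogonal of norm \<open>pi\<close> over all positive half-integers. Both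
  cases reduce to the vanishing sums of \<open>sums_inverse_sq_diff'\<close>: on the diagonal for
  the cross term of the square, off it for both partial fractions.\<close>

lemma sums_ker_mult_ker:
  assumes "i \<ge> 1" "j \<ge> 1"
  shows "(\<lambda>n. ker i (real n + 1/2) * ker j (real n + 1/2)) sums (if i = j then pi\<^sup>2 else 0)"
proof (cases "i = j")
  case True
  have "ker i (real n + 1/2) * ker i (real n + 1/2) =
      1 / (real n + 1/2 - real i)\<^sup>2 + 1 / (real n + 1/2 + real i)\<^sup>2 + 2 * (1 / ((real n + 1/2)\<^sup>2 - (real i)\<^sup>2))" for n
  proof -
    have e: "(real n + 1/2)\<^sup>2 - (real i)\<^sup>2 = (real n + 1/2 - real i) * (real n + 1/2 + real i)"
      by (simp add: power2_eq_square algebra_simps)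
    show ?thesis
      unfolding ker_def e by (simp add: power2_eq_square algebra_simps)
  qed
  with sums_add[OF sums_sq_kernel_over_half_integers[of i] sums_mult[OF sums_inverse_sq_diff'[OF assms(1)], of 2]] True
  show ?thesis by simp
next
  case False
  then have ne: "(real i)\<^sup>2 - (real j)\<^sup>2 \<noteq> 0" by simp
  \<comment> \<open>Partial fractions in the square of the half-integer, with poles at the squares
    of \<open>i\<close> and \<open>j\<close>.\<close>
  have "ker i (real n + 1/2) * ker j (real n + 1/2) =
     4 * (real i)\<^sup>2 / ((real i)\<^sup>2 - (real j)\<^sup>2) * (1 / ((real n + 1/2)\<^sup>2 - (real i)\<^sup>2))
     - 4 * (real j)\<^sup>2 / ((real i)\<^sup>2 - (real j)\<^sup>2) * (1 / ((real n + 1/2)\<^sup>2 - (real j)\<^sup>2))" for n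
  proof -
    have frac: "4 * T / (P * Q) = 4 * I / D * (1 / P) - 4 * J / D * (1 / Q)"
      if "P = T - I" "Q = T - J" "D = I - J" "P \<noteq> 0" "Q \<noteq> 0" "D \<noteq> 0" for T P Q I J D :: real
      using that(4-6) by (simp add: divide_simps) (simp add: that(1-3) algebra_simps)
    have prod: "2 * x / P * (2 * x / Q) = 4 * x\<^sup>2 / (P * Q)" for x P Q :: real
      by (simp add: power2_eq_square)
    have "ker i (real n + 1/2) * ker j (real n + 1/2) =
        4 * (real n + 1/2)\<^sup>2 / (((real n + 1/2)\<^sup>2 - (real i)\<^sup>2) * ((real n + 1/2)\<^sup>2 - (real j)\<^sup>2))"
      unfolding ker_eq(1)[OF half_int_nonzero(1,2)] by (rule prod)
    then show ?thesis
      using frac[OF refl refl refl half_int_nonzero(3)[of n i] half_int_nonzero(3)[of n j] ne] by simp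
  qed
  with sums_diff[OF
      sums_mult[OF sums_inverse_sq_diff'[OF assms(1)], of "4 * (real i)\<^sup>2 / ((real i)\<^sup>2 - (real j)\<^sup>2)"]
      sums_mult[OF sums_inverse_sq_diff'[OF assms(2)], of "4 * (real j)\<^sup>2 / ((real i)\<^sup>2 - (real j)\<^sup>2)"]] False
  show ?thesis by simp
qed

text \<open>Orthogonality to the omitted row \<open>k = 0\<close>, which is proportional to
  \<open>1 / t\<close>.\<close>

lemma sums_ker_div:
  assumes "j \<ge> 1"
  shows "(\<lambda>n. ker j (real n + 1/2) * (1 / (real n + 1/2))) sums 0"
proof -
  have "ker j (real n + 1/2) * (1 / (real n + 1/2)) = 2 * (1 / ((real n + 1/2)\<^sup>2 - (real j)\<^sup>2))" for n
  proof -
    have "real n + 1/2 \<noteq> 0" by linarith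
    have canc: "2 * x / P * (1 / x) = 2 * (1 / P)" if "x \<noteq> 0" for x P :: real
      using that by simp
    show ?thesis unfolding ker_eq(1)[OF half_int_nonzero(1,2)]
      by (rule canc) fact
  qed
  then show ?thesis using sums_mult[OF sums_inverse_sq_diff'[OF assms], of 2] by simp
qed

lemma four_sq_minus_1_nonzero: "4 * (real k)\<^sup>2 - 1 \<noteq> 0"
proof
  assume "4 * (real k)\<^sup>2 - 1 = 0"
  then have "real (4 * k\<^sup>2) = real 1" by simp
  then have "4 * k\<^sup>2 = 1" unfolding of_nat_eq_iff .
  then show False by presburger
qed

text \<open>The choice of \<open>beta\<close> is dictated by this vanishing: it cancels the term at the half-integer
  \<open>1/2\<close>, to which no unknown belongs.\<close>

lemma inv_ker_half: "inv_ker k (1/2) = 0"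
proof -
  have "ker k (1/2) = - (2 * beta k)"
    using half_int_nonzero[of 0 k] four_sq_minus_1_nonzero[of k]
    by (simp add: ker_eq(1) beta_def) (simp add: divide_simps power2_eq_square)
  then show ?thesis by (simp add: inv_ker_def)
qed

text \<open>\<open>inv_ker\<close> is a right inverse of the matrix. The correction by
  \<open>1 / t\<close> is orthogonal to every row with \<open>k \<ge> 1\<close>, so it leaves the
  orthogonality relations intact, and the zero at \<open>1/2\<close> allows the sum to start at
  \<open>3/2\<close>.\<close>

lemma sums_ker_mult_inv_ker:
  assumes "k \<ge> 1" "j \<ge> 1"
  shows "(\<lambda>n. ker k (real n + 3/2) * inv_ker j (real n + 3/2)) sums (if k = j then 1 else 0)"
proof -
  have "(\<lambda>n. (beta j * (ker k (real n + 1/2) * (1 / (real n + 1/2))) + ker k (real n + 1/2) * ker j (real n + 1/2)) / pi\<^sup>2)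
      sums ((beta j * 0 + (if k = j then pi\<^sup>2 else 0)) / pi\<^sup>2)"
    by (intro sums_divide sums_add sums_mult sums_ker_div sums_ker_mult_ker assms)
  then have "(\<lambda>n. ker k (real n + 1/2) * inv_ker j (real n + 1/2)) sums (if k = j then 1 else 0)"
    by (simp add: inv_ker_def add_divide_distrib distrib_left mult_ac if_distrib[of "\<lambda>x. x / _"] cong: if_cong)
  then show ?thesis
    by (rule sums_half_shift[of "\<lambda>t. ker k t * inv_ker j t"]) (simp add: inv_ker_half)
qed

text \<open>The Gram matrix is the identity plus a rank-one term, up to the factor
  \<open>1 / pi\<^sup>2\<close>: mixed terms vanish by orthogonality, and the square of the
  correction sums by \<open>sums_odd_squares\<close>.\<close>

lemma sums_inv_ker_mult_inv_ker:
  assumes "i \<ge> 1" "j \<ge> 1"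
  shows "(\<lambda>n. inv_ker i (real n + 3/2) * inv_ker j (real n + 3/2)) sums
           (((if i = j then 1 else 0) + beta i * beta j / 2) / pi\<^sup>2)"
proof -
  let ?t = "\<lambda>n. real n + 1/2"
  have "(\<lambda>n. (beta i * beta j * (1 / (?t n)\<^sup>2) + beta j * (ker i (?t n) * (1 / ?t n)) +
      beta i * (ker j (?t n) * (1 / ?t n)) + ker i (?t n) * ker j (?t n)) / pi ^ 4)
      sums ((beta i * beta j * (pi\<^sup>2 / 2) + beta j * 0 + beta i * 0 + (if i = j then pi\<^sup>2 else 0)) / pi ^ 4)"
    by (intro sums_divide sums_add sums_mult sums_ker_div sums_ker_mult_ker sums_odd_squares assms)
  also have "(\<lambda>n. (beta i * beta j * (1 / (?t n)\<^sup>2) + beta j * (ker i (?t n) * (1 / ?t n)) +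
      beta i * (ker j (?t n) * (1 / ?t n)) + ker i (?t n) * ker j (?t n)) / pi ^ 4)
      = (\<lambda>n. inv_ker i (?t n) * inv_ker j (?t n))"
  proof
    fix n
    have "pi ^ 4 = pi\<^sup>2 * pi\<^sup>2" by (simp flip: power_add)
    then show "(beta i * beta j * (1 / (?t n)\<^sup>2) + beta j * (ker i (?t n) * (1 / ?t n)) +
      beta i * (ker j (?t n) * (1 / ?t n)) + ker i (?t n) * ker j (?t n)) / pi ^ 4
      = inv_ker i (?t n) * inv_ker j (?t n)"
      unfolding inv_ker_def times_divide_times_eq
      by (simp add: ring_distribs power2_eq_square add_divide_distrib mult_ac)
  qed
  also have "(beta i * beta j * (pi\<^sup>2 / 2) + beta j * 0 + beta i * 0 + (if i = j then pi\<^sup>2 else 0)) / pi ^ 4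
     = ((if i = j then 1 else 0) + beta i * beta j / 2) / pi\<^sup>2"
    by (simp add: power4_eq_xxxx power2_eq_square add_divide_distrib)
  finally show ?thesis
    by (rule sums_half_shift[of "\<lambda>t. inv_ker i t * inv_ker j t"]) (simp add: inv_ker_half)
qed

text \<open>With \<open>a j = 1 / (j + 1/2)\<close> the difference \<open>a j - a (Suc j)\<close>
  equals the product \<open>a j * a (Suc j)\<close>, and \<open>beta (Suc j)\<close> is half of it.
  Squaring therefore leaves only odd-square series and a telescoping one.\<close>

lemma sums_beta_sq: "(\<lambda>j. (beta (Suc j))\<^sup>2) sums (pi\<^sup>2 / 4 - 2)"
proof -
  define a where "a j = 1 / (real j + 1/2)" for j
  have a_lim: "a \<longlonglongrightarrow> 0" unfolding a_def by (rule inverse_shift_tendsto_0)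
  have tel: "(\<lambda>j. a j - a (Suc j)) sums (a 0 - 0)"
    by (rule telescope_sums'[OF a_lim])
  have sq: "(\<lambda>j. (a j)\<^sup>2) sums (pi\<^sup>2 / 2)"
    using sums_odd_squares by (simp add: a_def power_divide)
  then have sq': "(\<lambda>j. (a (Suc j))\<^sup>2) sums (pi\<^sup>2 / 2 - 4)"
    by (subst sums_Suc_iff) (simp add: a_def power_divide)
  have "(\<lambda>j. ((a j)\<^sup>2 + (a (Suc j))\<^sup>2 - 2 * (a j - a (Suc j))) / 4) sums ((pi\<^sup>2 / 2 + (pi\<^sup>2 / 2 - 4) - 2 * (a 0 - 0)) / 4)"
    by (intro sums_divide sums_diff sums_add sums_mult sq sq' tel)
  moreover have "((a j)\<^sup>2 + (a (Suc j))\<^sup>2 - 2 * (a j - a (Suc j))) / 4 = (beta (Suc j))\<^sup>2" for j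
  proof -
    have p: "real j + 1/2 \<noteq> 0" "real j + 3/2 \<noteq> 0" by linarith+
    have prod: "a j - a (Suc j) = a j * a (Suc j)"
      using p by (simp add: a_def divide_simps)
    have "4 * (real (Suc j))\<^sup>2 - 1 = 4 * ((real j + 1/2) * (real j + 3/2))"
      by (simp add: power2_eq_square algebra_simps)
    then have b: "beta (Suc j) = (a j - a (Suc j)) / 2"
      unfolding prod by (simp add: beta_def a_def)
    have "2 * (a j - a (Suc j)) = 2 * a j * a (Suc j)"
      using prod by simp
    then show ?thesis
      unfolding b by (simp add: power_divide power2_diff)
  qed
  ultimately show ?thesis by (simp add: a_def diff_divide_distrib)
qed

section \<open>The inverse as an operator on l2\<close>

definition inv_op :: "(nat \<Rightarrow> real) \<Rightarrow> nat \<Rightarrow> real" where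
  "inv_op r n = (\<Sum>j. inv_ker (Suc j) (real n + 3/2) * r j)"

lemma l2_le_ker_row: "l2_le (\<lambda>n. ker (Suc j) (real n + 3/2)) pi"
proof -
  have "(\<lambda>n. ker (Suc j) (real n + 1/2) * ker (Suc j) (real n + 1/2)) sums pi\<^sup>2"
    using sums_ker_mult_ker[of "Suc j" "Suc j"] by simp
  then have S: "(\<lambda>n. (ker (Suc j) (real (Suc n) + 1/2))\<^sup>2) sums (pi\<^sup>2 - (ker (Suc j) (1/2))\<^sup>2)"
    by (subst sums_Suc_iff) (simp add: power2_eq_square)
  have "l2_le (\<lambda>n. ker (Suc j) (real (Suc n) + 1/2)) (sqrt (pi\<^sup>2 - (ker (Suc j) (1/2))\<^sup>2))"
    by (rule l2_le_of_sums_sq[OF S])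
  moreover have "real (Suc n) + 1/2 = real n + 3/2" for n by simp
  moreover have "sqrt (pi\<^sup>2 - (ker (Suc j) (1/2))\<^sup>2) \<le> pi"
    by (rule real_le_lsqrt) auto
  ultimately show ?thesis using l2_le_mono by (simp only:)
qed

text \<open>A qualitative bound suffices: it only makes the series defining \<open>inv_op\<close>
  converge.\<close>

lemma l2_le_inv_ker_row: "\<exists>c. l2_le (\<lambda>j. inv_ker (Suc j) (real n + 3/2)) c"
proof -
  let ?t = "real n + 3/2"
  have S: "summable (\<lambda>k. 1 / (?t - real (Suc k))\<^sup>2 + 1 / (?t + real (Suc k))\<^sup>2)"
    using sums_summable[OF sums_sq_kernel_over_integers[of "Suc n"]] by (simp add: algebra_simps)
  have s1: "summable (\<lambda>k. (1 / (?t - real (Suc k)))\<^sup>2)"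
    by (rule summable_comparison_test'[OF S]) (simp add: power_divide)
  have s2: "summable (\<lambda>k. (1 / (?t + real (Suc k)))\<^sup>2)"
    by (rule summable_comparison_test'[OF S]) (simp add: power_divide)
  obtain a b d where abd: "l2_le (\<lambda>k. 1 / (?t - real (Suc k))) a" "l2_le (\<lambda>k. 1 / (?t + real (Suc k))) b"
    "l2_le (\<lambda>k. beta (Suc k)) d"
    using l2_le_of_sums_sq s1 s2 sums_beta_sq by (meson summable_sums)
  have "l2_le (\<lambda>k. beta (Suc k) / ?t) ((1 / ?t) * d)"
    by (rule l2_le_dominated[OF abd(3)]) (auto simp: abs_mult)
  from l2_le_add[OF this l2_le_add[OF abd(1,2)]]
  have "l2_le (\<lambda>k. beta (Suc k) / ?t + ker (Suc k) ?t) ((1 / ?t) * d + (a + b))"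
    by (simp add: ker_def)
  then have "l2_le (\<lambda>k. inv_ker (Suc k) ?t) ((1 / pi\<^sup>2) * ((1 / ?t) * d + (a + b)))"
    by (rule l2_le_dominated) (auto simp: inv_ker_def abs_mult)
  then show ?thesis by blast
qed

lemma inv_op_sums:
  assumes "l2_le r c"
  shows "(\<lambda>j. inv_ker (Suc j) (real n + 3/2) * r j) sums inv_op r n"
proof -
  obtain d where "l2_le (\<lambda>j. inv_ker (Suc j) (real n + 3/2)) d" using l2_le_inv_ker_row by blast
  from l2_le_mult(1)[OF this assms] show ?thesis
    unfolding inv_op_def by (intro summable_sums) (rule summable_rabs_cancel)
qed

lemma inv_op_diff:
  assumes "l2_le r c" "l2_le s d"
  shows "inv_op (\<lambda>j. r j - s j) n = inv_op r n - inv_op s n"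
  using sums_unique[OF sums_diff[OF inv_op_sums[OF assms(1)] inv_op_sums[OF assms(2)]]]
  unfolding inv_op_def by (simp add: algebra_simps)

lemma sums_finite_inv_op_sq:
  "(\<lambda>n. (\<Sum>j<J. inv_ker (Suc j) (real n + 3/2) * r j)\<^sup>2) sums
     (((\<Sum>j<J. (r j)\<^sup>2) + (\<Sum>j<J. beta (Suc j) * r j)\<^sup>2 / 2) / pi\<^sup>2)"
proof -
  let ?G = "\<lambda>i j. ((if i = j then 1 else 0) + beta (Suc i) * beta (Suc j) / 2) / pi\<^sup>2"
  have "(\<lambda>n. \<Sum>i<J. \<Sum>j<J. r i * r j * (inv_ker (Suc i) (real n + 3/2) * inv_ker (Suc j) (real n + 3/2)))
     sums (\<Sum>i<J. \<Sum>j<J. r i * r j * ?G i j)"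
    using sums_inv_ker_mult_inv_ker by (intro sums_sum sums_mult) fastforce
  moreover have "(\<Sum>i<J. \<Sum>j<J. r i * r j * (inv_ker (Suc i) (real n + 3/2) * inv_ker (Suc j) (real n + 3/2)))
     = (\<Sum>j<J. inv_ker (Suc j) (real n + 3/2) * r j)\<^sup>2" for n
    by (simp add: power2_eq_square sum_product mult_ac)
  moreover have "(\<Sum>i<J. \<Sum>j<J. r i * r j * ?G i j) = 
      ((\<Sum>j<J. (r j)\<^sup>2) + (\<Sum>j<J. beta (Suc j) * r j)\<^sup>2 / 2) / pi\<^sup>2"
  proof -
    have "(\<Sum>i<J. \<Sum>j<J. r i * r j * ?G i j) = (\<Sum>i<J. \<Sum>j<J. (if i = j then r i * r j else 0) / pi\<^sup>2 +
        (beta (Suc i) * r i) * (beta (Suc j) * r j) / 2 / pi\<^sup>2)"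
      by (intro sum.cong refl) (simp add: field_simps)
    also have "\<dots> = (\<Sum>i<J. r i * r i) / pi\<^sup>2 + (\<Sum>j<J. beta (Suc j) * r j)\<^sup>2 / 2 / pi\<^sup>2"
      by (simp add: sum.distrib power2_eq_square sum_product flip: sum_divide_distrib)
    finally show ?thesis by (simp add: power2_eq_square add_divide_distrib)
  qed
  ultimately show ?thesis by simp
qed

text \<open>By Cauchy-Schwarz against \<open>beta\<close>, the Gram form is at most
  \<open>1 + (pi\<^sup>2 / 4 - 2) / 2 = pi\<^sup>2 / 8\<close> times the squared norm. Division by
  \<open>pi\<^sup>2\<close> gives operator norm at most \<open>1 / sqrt 8\<close>, uniformly in the
  truncation.\<close>

lemma l2_le_finite_inv_op:
  assumes "l2_le r c"
  shows "l2_le (\<lambda>n. \<Sum>j<J. inv_ker (Suc j) (real n + 3/2) * r j) (c / sqrt 8)"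
proof -
  have c: "0 \<le> c" by (rule l2_le_nonneg[OF assms])
  have R: "(\<Sum>j<J. (r j)\<^sup>2) \<le> c\<^sup>2"
    using assms by (simp add: l2_le_iff_sum_sq[OF c])
  have "\<bar>\<Sum>j<J. beta (Suc j) * r j\<bar> \<le> (\<Sum>j<J. \<bar>beta (Suc j)\<bar> * \<bar>r j\<bar>)"
    by (rule order_trans[OF sum_abs]) (simp add: abs_mult)
  also have "\<dots> \<le> L2_set (\<lambda>j. beta (Suc j)) {..<J} * L2_set r {..<J}"
    by (rule L2_set_mult_ineq)
  also have "\<dots> \<le> sqrt (pi\<^sup>2 / 4 - 2) * c"
    by (intro mult_mono l2_leD[OF l2_le_of_sums_sq[OF sums_beta_sq]] l2_leD[OF assms]
        l2_le_nonneg[OF l2_le_of_sums_sq[OF sums_beta_sq]]) auto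
  finally have "(\<Sum>j<J. beta (Suc j) * r j)\<^sup>2 \<le> (sqrt (pi\<^sup>2 / 4 - 2) * c)\<^sup>2"
    by (metis abs_ge_zero power2_abs power_mono)
  also have "\<dots> = (pi\<^sup>2 / 4 - 2) * c\<^sup>2"
    using l2_le_nonneg[OF l2_le_of_sums_sq[OF sums_beta_sq]] by (simp add: power_mult_distrib)
  finally have B: "(\<Sum>j<J. beta (Suc j) * r j)\<^sup>2 \<le> (pi\<^sup>2 / 4 - 2) * c\<^sup>2" .
  have "((\<Sum>j<J. (r j)\<^sup>2) + (\<Sum>j<J. beta (Suc j) * r j)\<^sup>2 / 2) / pi\<^sup>2 \<le> (c\<^sup>2 + (pi\<^sup>2 / 4 - 2) * c\<^sup>2 / 2) / pi\<^sup>2"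
    by (intro divide_right_mono add_mono R B) auto
  also have "\<dots> = c\<^sup>2 / 8"
    by (simp add: field_simps)
  also have "\<dots> = (c / sqrt 8)\<^sup>2" by (simp add: power_divide)
  finally have "sqrt (((\<Sum>j<J. (r j)\<^sup>2) + (\<Sum>j<J. beta (Suc j) * r j)\<^sup>2 / 2) / pi\<^sup>2) \<le> c / sqrt 8"
    using c by (intro real_le_lsqrt) auto
  then show ?thesis
    by (rule l2_le_mono[OF l2_le_of_sums_sq[OF sums_finite_inv_op_sq]])
qed

lemma l2_le_inv_op:
  assumes "l2_le r c"
  shows "l2_le (inv_op r) (c / sqrt 8)"
proof (rule l2_le_limit)
  show "(\<lambda>J. \<Sum>j<J. inv_ker (Suc j) (real n + 3/2) * r j) \<longlonglongrightarrow> inv_op r n" for n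
    using inv_op_sums[OF assms, of n] by (simp add: sums_def)
  show "eventually (\<lambda>J. l2_le (\<lambda>n. \<Sum>j<J. inv_ker (Suc j) (real n + 3/2) * r j) (c / sqrt 8)) sequentially"
    by (simp add: l2_le_finite_inv_op[OF assms])
qed

text \<open>Biorthogonality settles the finite head of \<open>r\<close> exactly. The tail is small
  in norm, and pairing a row with its image costs at most \<open>pi / sqrt 8\<close> times that
  norm.\<close>

lemma sums_ker_mult_inv_op:
  assumes "l2_le r c"
  shows "(\<lambda>n. ker (Suc k) (real n + 3/2) * inv_op r n) sums r k"
proof -
  let ?A = "\<lambda>n. ker (Suc k) (real n + 3/2)"
  have S: "summable (\<lambda>n. ?A n * inv_op r n)"
    by (rule summable_rabs_cancel[OF l2_le_mult(1)[OF l2_le_ker_row l2_le_inv_op[OF assms]]])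
  have "\<bar>(\<Sum>n. ?A n * inv_op r n) - r k\<bar> \<le> 0 + e" if "e > 0" for e
  proof -
    \<comment> \<open>Chosen so that \<open>pi * (e' / sqrt 8) = e\<close>.\<close>
    define e' where "e' = e * sqrt 8 / pi"
    have "e' > 0" using that by (simp add: e'_def)
    then obtain J0 where J0: "\<And>i. i \<ge> J0 \<Longrightarrow> l2_le (\<lambda>n. if n < i then 0 else r n) e'"
      using l2_le_tail[OF assms] by metis
    \<comment> \<open>\<open>J\<close> exceeds \<open>k\<close>, so coordinate \<open>k\<close> lies
      in the head.\<close>
    define J where "J = max J0 (Suc k)"
    define p where "p = (\<lambda>n. if n < J then r n else 0)"
    define q where "q = (\<lambda>n. if n < J then 0 else r n)"
    have q: "l2_le q e'" unfolding q_def J_def by (rule J0) simp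
    have inv_p: "inv_op p n = (\<Sum>j<J. inv_ker (Suc j) (real n + 3/2) * r j)" for n
    proof -
      have "inv_op p n = (\<Sum>j<J. inv_ker (Suc j) (real n + 3/2) * p j)"
        unfolding inv_op_def by (intro suminf_finite) (auto simp: p_def)
      then show ?thesis by (simp add: p_def)
    qed
    have "p = (\<lambda>n. r n - q n)" by (auto simp: p_def q_def)
    then have split: "inv_op p n = inv_op r n - inv_op q n" for n
      using inv_op_diff[OF assms q] by simp
    have "(\<lambda>n. \<Sum>j<J. r j * (?A n * inv_ker (Suc j) (real n + 3/2))) sums (\<Sum>j<J. r j * (if Suc k = Suc j then 1 else 0))"
      by (intro sums_sum sums_mult sums_ker_mult_inv_ker) auto
    moreover have "(\<Sum>j<J. r j * (if Suc k = Suc j then 1 else 0)) = r k"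
      by (simp add: J_def if_distrib cong: if_cong) 
    moreover have "(\<Sum>j<J. r j * (?A n * inv_ker (Suc j) (real n + 3/2))) = ?A n * inv_op p n" for n
      by (simp add: inv_p sum_distrib_left mult_ac)
    ultimately have P: "(\<lambda>n. ?A n * inv_op p n) sums r k" by simp
    note Q = l2_le_mult[OF l2_le_ker_row[of k] l2_le_inv_op[OF q]]
    have "(\<Sum>n. ?A n * inv_op r n) - r k = (\<Sum>n. ?A n * inv_op q n)"
      using sums_unique[OF sums_diff[OF summable_sums[OF S] P]] split by (simp add: algebra_simps)
    also have "\<bar>\<dots>\<bar> \<le> pi * (e' / sqrt 8)"
      using summable_rabs[OF Q(1)] Q(2) by linarith
    also have "\<dots> = e" by (simp add: e'_def)
    finally show ?thesis by simp
  qed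
  then have "\<bar>(\<Sum>n. ?A n * inv_op r n) - r k\<bar> \<le> 0" by (rule field_le_epsilon)
  then show ?thesis using summable_sums[OF S] by simp
qed

text \<open>After its first term the Basel series is dominated by a telescoping series with sum
  \<open>2/3\<close>, so \<open>pi\<^sup>2 / 6 \<le> 5/3\<close>.\<close>

lemma pi_squared_le_10: "pi\<^sup>2 \<le> 10"
proof -
  have "(\<lambda>n. 1 / (real n + 1)\<^sup>2) sums (pi\<^sup>2 / 6)"
    using inverse_squares_sums by (simp add: add.commute)
  then have A: "(\<lambda>n. 1 / (real (Suc n) + 1)\<^sup>2) sums (pi\<^sup>2 / 6 - 1)"
    by (subst sums_Suc_iff) simp
  have B: "(\<lambda>n. 1 / (real n + 3/2) - 1 / (real (Suc n) + 3/2)) sums (1 / (real 0 + 3/2) - 0)"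
    by (rule telescope_sums'[OF inverse_shift_tendsto_0])
  have "1 / (real (Suc n) + 1)\<^sup>2 \<le> 1 / (real n + 3/2) - 1 / (real (Suc n) + 3/2)" for n
  proof -
    have "1 / (real n + 3/2) - 1 / (real (Suc n) + 3/2) = 1 / ((real n + 3/2) * (real n + 5/2))"
      by (simp add: divide_simps)
    moreover have "(real n + 3/2) * (real n + 5/2) \<le> (real (Suc n) + 1)\<^sup>2"
      by (simp add: power2_eq_square algebra_simps)
    ultimately show ?thesis by (simp add: frac_le)
  qed
  from sums_le[OF this A B] show ?thesis by simp
qed

section \<open>The sine substitution\<close>

lemma cos_ge_quadratic: "1 - x\<^sup>2 / 2 \<le> cos (x::real)"
proof -
  have "(sin (x / 2))\<^sup>2 \<le> (x / 2)\<^sup>2"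
    using abs_sin_x_le_abs_x[of "x / 2"] by (metis abs_ge_zero power2_abs power_mono)
  then show ?thesis using cos_double_sin[of "x / 2"] by (simp add: power_divide)
qed

lemma sin_ge_cubic:
  assumes "0 \<le> (x::real)" shows "x - x ^ 3 / 6 \<le> sin x"
proof -
  have "sin 0 - (0 - 0 ^ 3 / 6) \<le> sin x - (x - x ^ 3 / 6)"
  proof (rule DERIV_nonneg_imp_nondecreasing[OF assms])
    fix y :: real
    have "((\<lambda>x. sin x - (x - x ^ 3 / 6)) has_real_derivative cos y - (1 - y\<^sup>2 / 2)) (at y)"
      by (auto intro!: derivative_eq_intros)
    then show "\<exists>d. ((\<lambda>x. sin x - (x - x ^ 3 / 6)) has_real_derivative d) (at y) \<and> 0 \<le> d"
      using cos_ge_quadratic[of y] by (intro exI[of _ "cos y - (1 - y\<^sup>2 / 2)"]) auto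
  qed
  then show ?thesis by simp
qed

text \<open>The local inverse of \<open>y \<mapsto> sin (pi * y) / pi\<close>, recovering a shift
  from the unknown of the linear system.\<close>

definition arcsin_pi :: "real \<Rightarrow> real" where
  "arcsin_pi x = arcsin (pi * x) / pi"

lemma pi_mult_squared_le:
  assumes "\<bar>y\<bar> \<le> 0.13" shows "(pi * y)\<^sup>2 \<le> 0.169"
proof -
  have "y\<^sup>2 \<le> 0.13\<^sup>2" using assms by (metis abs_ge_zero power2_abs power_mono)
  then have "pi\<^sup>2 * y\<^sup>2 \<le> 10 * 0.13\<^sup>2" by (intro mult_mono pi_squared_le_10) auto
  then show ?thesis by (simp add: power_mult_distrib) (simp add: power2_eq_square)
qed

text \<open>The cubic bound loses at most the factor \<open>1 - 0.169 / 6\<close>, which exceeds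
  \<open>1 / 1.04\<close>.\<close>

lemma pi_mult_minus_cubic_le_sin:
  assumes "0 \<le> y" "y \<le> 0.13" shows "y / 1.04 \<le> sin (pi * y) / pi"
proof -
  have "(pi * y) ^ 3 \<le> (pi * y) * 0.169"
    using pi_mult_squared_le[of y] assms
    by (simp add: power3_eq_cube power2_eq_square mult.assoc mult_left_mono)
  then have "pi * (y / 1.04) \<le> pi * y - (pi * y) ^ 3 / 6"
    using mult_nonneg_nonneg[OF pi_ge_zero assms(1)] by simp
  also have "\<dots> \<le> sin (pi * y)"
    using assms by (intro sin_ge_cubic) auto
  finally show ?thesis by (simp add: pos_le_divide_eq mult.commute)
qed

lemma arcsin_pi_props:
  assumes "\<bar>x\<bar> \<le> 1/8"
  shows sin_arcsin_pi: "sin (pi * arcsin_pi x) / pi = x"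
    and arcsin_pi_bound: "\<bar>arcsin_pi x\<bar> \<le> 1.04 * \<bar>x\<bar>"
    and arcsin_pi_small: "\<bar>arcsin_pi x\<bar> \<le> 0.13"
proof -
  let ?d = "arcsin_pi x"
  have x1: "\<bar>pi * x\<bar> \<le> pi / 8" using assms by (simp add: abs_mult)
  then have x2: "- 1 \<le> pi * x" "pi * x \<le> 1" using pi_less_4 by linarith+
  have pd: "pi * ?d = arcsin (pi * x)" by (simp add: arcsin_pi_def)
  show s: "sin (pi * ?d) / pi = x"
    unfolding pd using x2 by simp
  \<comment> \<open>Here \<open>0.13 / 1.04\<close> is exactly \<open>1/8\<close>, so the sine on
    the interval of radius \<open>0.13\<close> covers all admissible values \<open>pi * x\<close>;
    monotonicity of \<open>arcsin\<close> does the rest.\<close>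
  have s8: "pi / 8 \<le> sin (pi * 0.13)"
    using pi_mult_minus_cubic_le_sin[of "0.13"] by (simp add: pos_le_divide_eq)
  have "pi * x \<le> sin (pi * 0.13)" using x1 s8 by linarith
  from arcsin_le_arcsin[OF x2(1) this sin_le_one] have "arcsin (pi * x) \<le> pi * 0.13"
    by (subst (asm) arcsin_sin) simp_all
  moreover have "sin (- (pi * 0.13)) \<le> pi * x" using x1 s8 unfolding sin_minus by linarith
  from arcsin_le_arcsin[OF sin_ge_minus_one this x2(2)] have "- (pi * 0.13) \<le> arcsin (pi * x)"
    by (subst (asm) arcsin_sin) (use pi_gt_zero in \<open>simp_all del: pi_gt_zero\<close>)
  ultimately have "arcsin (pi * x) \<le> pi * 0.13" "- (pi * 0.13) \<le> arcsin (pi * x)" .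
  then have "?d \<le> 0.13" "- 0.13 \<le> ?d"
    unfolding arcsin_pi_def by (auto simp: divide_simps mult.commute)
  then show b: "\<bar>?d\<bar> \<le> 0.13" by linarith
  have "\<bar>sin (pi * \<bar>?d\<bar>)\<bar> = \<bar>sin (pi * ?d)\<bar>" by (simp add: abs_if)
  then have "\<bar>x\<bar> = \<bar>sin (pi * \<bar>?d\<bar>) / pi\<bar>" using s by (metis abs_divide)
  moreover have "\<bar>?d\<bar> / 1.04 \<le> sin (pi * \<bar>?d\<bar>) / pi"
    using b by (intro pi_mult_minus_cubic_le_sin) auto
  ultimately have "\<bar>?d\<bar> / 1.04 \<le> \<bar>x\<bar>" by linarith
  then show "\<bar>?d\<bar> \<le> 1.04 * \<bar>x\<bar>" by simp
qed

text \<open>On the relevant interval the derivative \<open>cos (pi * t)\<close> of the inverse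
  function is at least \<open>1 - 0.169 / 2\<close>, which exceeds \<open>1 / 1.1\<close>.\<close>

lemma arcsin_pi_lipschitz:
  assumes "\<bar>x\<bar> \<le> 1/8" "\<bar>y\<bar> \<le> 1/8"
  shows "\<bar>arcsin_pi x - arcsin_pi y\<bar> \<le> 1.1 * \<bar>x - y\<bar>"
proof -
  have expand: "d - e \<le> 1.1 * (sin (pi * d) / pi - sin (pi * e) / pi)"
    if "e \<le> d" "- 0.13 \<le> e" "d \<le> 0.13" for d e
  proof -
    have "sin (pi * e) / pi - e / 1.1 \<le> sin (pi * d) / pi - d / 1.1"
    proof (rule DERIV_nonneg_imp_nondecreasing[OF that(1)])
      fix t assume t: "e \<le> t" "t \<le> d"
      have "((\<lambda>t. sin (pi * t) / pi - t / 1.1) has_real_derivative cos (pi * t) - 1 / 1.1) (at t)"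
        by (auto intro!: derivative_eq_intros)
      moreover have "\<bar>t\<bar> \<le> 0.13" using t that by linarith
      from pi_mult_squared_le[OF this] have "0 \<le> cos (pi * t) - 1 / 1.1"
        using cos_ge_quadratic[of "pi * t"] by simp
      ultimately show "\<exists>a. ((\<lambda>t. sin (pi * t) / pi - t / 1.1) has_real_derivative a) (at t) \<and> 0 \<le> a" by blast
    qed
    then show ?thesis by simp
  qed
  have "- 0.13 \<le> arcsin_pi x" "arcsin_pi x \<le> 0.13" "- 0.13 \<le> arcsin_pi y" "arcsin_pi y \<le> 0.13"
    using arcsin_pi_small[OF assms(1)] arcsin_pi_small[OF assms(2)] by linarith+
  then have "arcsin_pi x \<le> arcsin_pi y \<Longrightarrow> arcsin_pi y - arcsin_pi x \<le> 1.1 * (y - x)"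
    "arcsin_pi y \<le> arcsin_pi x \<Longrightarrow> arcsin_pi x - arcsin_pi y \<le> 1.1 * (x - y)"
    using expand sin_arcsin_pi[OF assms(1)] sin_arcsin_pi[OF assms(2)] by metis+
  then show ?thesis by (cases "arcsin_pi x \<le> arcsin_pi y") (simp_all add: abs_if)
qed

section \<open>The nonlinear remainder\<close>

definition ker_integral :: "nat \<Rightarrow> real \<Rightarrow> real \<Rightarrow> real" where
  "ker_integral k t d = (LBINT y=ereal 0..ereal d. cos (pi * y) * ker k (t - y))"

text \<open>The error made by freezing the kernel at \<open>y = 0\<close>, since
  \<open>sin (pi * d) / pi\<close> is the integral of the cosine.\<close>

definition remainder :: "nat \<Rightarrow> real \<Rightarrow> real \<Rightarrow> real" where
  "remainder k t d = ker_integral k t d - ker k t * (sin (pi * d) / pi)"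

text \<open>The constant is \<open>0.74 = 1 - 0.13 / (1/2)\<close>: moving a point at distance at
  least \<open>1/2\<close> from a pole by at most \<open>0.13\<close> keeps this fraction of the
  distance.\<close>

definition maj :: "nat \<Rightarrow> real \<Rightarrow> real" where
  "maj k t = (1 / (t - real k)\<^sup>2 + 1 / (t + real k)\<^sup>2) / 0.74"

lemma maj_nonneg: "0 \<le> maj k t"
  by (simp add: maj_def)

lemma inverse_diff_bound:
  fixes a y :: real
  assumes "\<bar>a\<bar> \<ge> 1/2" "\<bar>y\<bar> \<le> 0.13"
  shows "\<bar>1 / (a - y) - 1 / a\<bar> \<le> \<bar>y\<bar> * (1 / a\<^sup>2 / 0.74)"
proof -
  have nz: "a \<noteq> 0" "a - y \<noteq> 0" using assms by auto
  then have e: "1 / (a - y) - 1 / a = y / ((a - y) * a)" by (simp add: divide_simps)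
  have "\<bar>y\<bar> \<le> 13 / 100" using assms(2) by simp
  then have "74 / 100 * \<bar>a\<bar> \<le> \<bar>a - y\<bar>" using assms(1) by linarith
  then have "0.74 * \<bar>a\<bar> \<le> \<bar>a - y\<bar>" by simp
  then have "(0.74 * \<bar>a\<bar>) * \<bar>a\<bar> \<le> \<bar>a - y\<bar> * \<bar>a\<bar>" by (rule mult_right_mono) simp
  then have "0.74 * a\<^sup>2 \<le> \<bar>(a - y) * a\<bar>" by (simp add: power2_eq_square abs_mult)
  then have "\<bar>y\<bar> / \<bar>(a - y) * a\<bar> \<le> \<bar>y\<bar> / (0.74 * a\<^sup>2)"
    using nz by (intro divide_left_mono) auto
  then show ?thesis unfolding e by (simp add: mult.commute)
qed

lemma ker_diff_bound:
  assumes "\<bar>t - real k\<bar> \<ge> 1/2" "\<bar>t + real k\<bar> \<ge> 1/2" "\<bar>y\<bar> \<le> 0.13"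
  shows "\<bar>ker k (t - y) - ker k t\<bar> \<le> \<bar>y\<bar> * maj k t"
proof -
  have "\<bar>ker k (t - y) - ker k t\<bar> \<le> \<bar>1 / (t - real k - y) - 1 / (t - real k)\<bar> + \<bar>1 / (t + real k - y) - 1 / (t + real k)\<bar>"
    unfolding ker_def by (simp add: algebra_simps)
  also have "\<dots> \<le> \<bar>y\<bar> * (1 / (t - real k)\<^sup>2 / 0.74) + \<bar>y\<bar> * (1 / (t + real k)\<^sup>2 / 0.74)"
    by (intro add_mono inverse_diff_bound assms)
  also have "\<dots> = \<bar>y\<bar> * maj k t"
    by (simp only: maj_def add_divide_distrib distrib_left)
  finally show ?thesis .
qed

lemma remainder_has_derivative:
  assumes "\<bar>t - real k\<bar> \<ge> 1/2" "\<bar>t + real k\<bar> \<ge> 1/2" "\<bar>y\<bar> \<le> 0.13"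
  shows "(remainder k t has_real_derivative cos (pi * y) * (ker k (t - y) - ker k t)) (at y)"
proof -
  let ?f = "\<lambda>y. cos (pi * y) * ker k (t - y)"
  \<comment> \<open>Both poles are at distance at least \<open>1/2\<close> from \<open>t\<close>, so
    this interval avoids them and has every admissible \<open>y\<close> in its interior.\<close>
  have "continuous_on {- 1/4..1/4} ?f"
    unfolding ker_def
  proof (intro continuous_intros ballI)
    fix x :: real assume "x \<in> {- 1/4..1/4}"
    then show "t - x - real k \<noteq> 0" "t - x + real k \<noteq> 0"
      using assms(1,2) by (simp_all, linarith+)
  qed
  then have "((\<lambda>u. LBINT y=ereal 0..ereal u. ?f y) has_vector_derivative ?f y) (at y within {- 1/4..1/4})"
    using assms(3) interval_integral_FTC2[of "-1/4" 0 "1/4" ?f y] by auto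
  moreover have "y \<in> interior {- 1/4..1/4}" using assms(3) by auto
  ultimately have "((\<lambda>u. LBINT y=ereal 0..ereal u. ?f y) has_vector_derivative ?f y) (at y)"
    by (simp only: at_within_interior)
  then have K: "((\<lambda>u. ker_integral k t u) has_real_derivative ?f y) (at y)"
    unfolding has_real_derivative_iff_has_vector_derivative ker_integral_def .
  have S: "((\<lambda>u. sin (pi * u) / pi) has_real_derivative cos (pi * y)) (at y)"
    by (auto intro!: derivative_eq_intros)
  have "((\<lambda>u. remainder k t u) has_real_derivative ?f y - ker k t * cos (pi * y)) (at y)"
    unfolding remainder_def by (rule DERIV_diff[OF K DERIV_cmult[OF S]])
  then show ?thesis by (simp add: algebra_simps)
qed

text \<open>Supplies \<open>y * \<bar>y\<bar> / 2\<close> as an antiderivative of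
  \<open>\<bar>y\<bar>\<close> across 0, so that shifts of opposite sign need no separate
  treatment.\<close>

lemma has_derivative_mult_abs: "((\<lambda>y. y * \<bar>y\<bar>) has_real_derivative 2 * \<bar>x\<bar>) (at (x::real))"
proof -
  consider "x > 0" | "x < 0" | "x = 0" by linarith
  then show ?thesis
  proof cases
    case 1
    show ?thesis
    proof (rule has_field_derivative_transform_within_open)
      show "((\<lambda>y. y * y) has_real_derivative 2 * \<bar>x\<bar>) (at x)"
        using 1 by (auto intro!: derivative_eq_intros)
      show "open {0::real<..}" by simp
    qed (use 1 in auto)
  next
    case 2
    show ?thesis
    proof (rule has_field_derivative_transform_within_open)
      show "((\<lambda>y. - (y * y)) has_real_derivative 2 * \<bar>x\<bar>) (at x)"
        using 2 by (auto intro!: derivative_eq_intros)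
      show "open {..<0::real}" by simp
    qed (use 2 in auto)
  next
    case 3
    have "((\<lambda>h::real. \<bar>h\<bar>) \<longlongrightarrow> \<bar>0\<bar>) (at 0)" by (intro tendsto_intros)
    then have "((\<lambda>h::real. h * \<bar>h\<bar> / h) \<longlongrightarrow> \<bar>0\<bar>) (at 0)"
      by (rule Lim_transform_eventually) (auto simp: eventually_at_filter)
    then show ?thesis using 3 by (simp add: DERIV_def)
  qed
qed

text \<open>The derivative of the remainder is at most \<open>\<bar>y\<bar> * maj k t\<close> in
  absolute value, so it is compared with the antiderivative of this majorant.\<close>

lemma remainder_lipschitz:
  assumes t: "\<bar>t - real k\<bar> \<ge> 1/2" "\<bar>t + real k\<bar> \<ge> 1/2"
    and "\<bar>d\<bar> \<le> 0.13" "\<bar>e\<bar> \<le> 0.13"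
  shows "\<bar>remainder k t d - remainder k t e\<bar> \<le> \<bar>d - e\<bar> * (\<bar>d\<bar> + \<bar>e\<bar>) / 2 * maj k t"
proof -
  have *: "\<bar>remainder k t d - remainder k t e\<bar> \<le> (d * \<bar>d\<bar> - e * \<bar>e\<bar>) / 2 * maj k t"
    if "e \<le> d" "\<bar>d\<bar> \<le> 0.13" "\<bar>e\<bar> \<le> 0.13" for d e
  proof -
    have deriv: "((\<lambda>y. y * \<bar>y\<bar> / 2 * maj k t + c * remainder k t y) has_real_derivative
         \<bar>y\<bar> * maj k t + c * (cos (pi * y) * (ker k (t - y) - ker k t))) (at y)"
      if "\<bar>y\<bar> \<le> 0.13" for y c
      using DERIV_add[OF DERIV_cmult_right[OF DERIV_cdivide[OF has_derivative_mult_abs[of y], of 2], of "maj k t"]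
          DERIV_cmult[OF remainder_has_derivative[OF t that], of c]] by simp
    have bound: "\<bar>cos (pi * y) * (ker k (t - y) - ker k t)\<bar> \<le> \<bar>y\<bar> * maj k t" if "\<bar>y\<bar> \<le> 0.13" for y
      using mult_mono[OF abs_cos_le_one[of "pi * y"] ker_diff_bound[OF t that]] by (simp add: abs_mult)
    \<comment> \<open>The two signs of \<open>c\<close> give the two halves of the absolute
      value.\<close>
    have "e * \<bar>e\<bar> / 2 * maj k t + c * remainder k t e \<le> d * \<bar>d\<bar> / 2 * maj k t + c * remainder k t d"
      if "c = 1 \<or> c = -1" for c
    proof (rule DERIV_nonneg_imp_nondecreasing[OF \<open>e \<le> d\<close>])
      fix y assume "e \<le> y" "y \<le> d"
      then have y: "\<bar>y\<bar> \<le> 0.13" using \<open>\<bar>d\<bar> \<le> 0.13\<close> \<open>\<bar>e\<bar> \<le> 0.13\<close> by linarith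
      have "0 \<le> \<bar>y\<bar> * maj k t + c * (cos (pi * y) * (ker k (t - y) - ker k t))"
        using bound[OF y] that by auto
      then show "\<exists>a. ((\<lambda>y. y * \<bar>y\<bar> / 2 * maj k t + c * remainder k t y) has_real_derivative a) (at y) \<and> 0 \<le> a"
        using deriv[OF y] by blast
    qed
    from this[of 1] this[of "-1"] show ?thesis
      by (simp add: left_diff_distrib diff_divide_distrib)
  qed
  have **: "d * \<bar>d\<bar> - e * \<bar>e\<bar> \<le> \<bar>d - e\<bar> * (\<bar>d\<bar> + \<bar>e\<bar>)" if "e \<le> d" for d e :: real
  proof -
    consider "0 \<le> e" | "e < 0" "0 \<le> d" | "d < 0" using that by linarith
    then show ?thesis
    proof cases
      case 2
      then show ?thesis by (simp add: abs_if algebra_simps mult_nonneg_nonpos)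
    qed (use that in \<open>auto simp: abs_if algebra_simps\<close>)
  qed
  have "\<bar>remainder k t d - remainder k t e\<bar> \<le> \<bar>d - e\<bar> * (\<bar>d\<bar> + \<bar>e\<bar>) / 2 * maj k t"
    if "e \<le> d" "\<bar>d\<bar> \<le> 0.13" "\<bar>e\<bar> \<le> 0.13" for d e
    by (rule order_trans[OF *[OF that]]) (intro mult_right_mono divide_right_mono ** that maj_nonneg; simp)
  from this[of d e] this[of e d] show ?thesis
    using assms(3,4) by (cases "e \<le> d") (auto simp: abs_minus_commute add.commute)
qed

lemma half_int_dist:
  "\<bar>real n + 3/2 - real k\<bar> \<ge> 1/2" "\<bar>real n + 3/2 + real k\<bar> \<ge> 1/2"
proof -
  have "\<bar>2 * int n + 3 - 2 * int k\<bar> \<ge> 1" by presburger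
  then have "\<bar>real_of_int (2 * int n + 3 - 2 * int k)\<bar> \<ge> 1" by linarith
  then have "\<bar>2 * real n + 3 - 2 * real k\<bar> \<ge> 1" by simp
  then show "\<bar>real n + 3/2 - real k\<bar> \<ge> 1/2" by linarith
qed simp

text \<open>The poles are at distances at least \<open>1/2\<close> and \<open>5/2\<close>, and
  \<open>4.16 = 4 + 4/25\<close>.\<close>

lemma maj_le: "maj (Suc k) (real n + 3/2) \<le> 4.16 / 0.74"
proof -
  have "(1/2)\<^sup>2 \<le> (real n + 3/2 - real (Suc k))\<^sup>2"
    using half_int_dist(1)[of n "Suc k"] by (metis abs_le_square_iff abs_of_nonneg zero_le_divide_1_iff zero_le_numeral)
  moreover have "(5/2)\<^sup>2 \<le> (real n + 3/2 + real (Suc k))\<^sup>2"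
    by (intro power_mono) auto
  ultimately have "1 / (real n + 3/2 - real (Suc k))\<^sup>2 \<le> 1 / (1/2)\<^sup>2" "1 / (real n + 3/2 + real (Suc k))\<^sup>2 \<le> 1 / (5/2)\<^sup>2"
    by (intro divide_left_mono mult_pos_pos; auto simp: power2_eq_square)+
  then have "1 / (real n + 3/2 - real (Suc k))\<^sup>2 + 1 / (real n + 3/2 + real (Suc k))\<^sup>2 \<le> 4.16"
    by (simp add: power2_eq_square)
  then show ?thesis unfolding maj_def by (intro divide_right_mono) auto
qed

lemma sum_maj_le: "(\<Sum>k<K. maj (Suc k) (real n + 3/2)) \<le> 10 / 0.74"
proof -
  have e: "real (Suc n) + 1/2 = real n + 3/2" by simp
  note S = sums_sq_kernel_over_integers[of "Suc n", unfolded e]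
  have "(\<Sum>k<K. 1 / (real n + 3/2 - real (Suc k))\<^sup>2 + 1 / (real n + 3/2 + real (Suc k))\<^sup>2) \<le> pi\<^sup>2 - 1 / (real n + 3/2)\<^sup>2"
    unfolding sums_unique[OF S] by (intro sum_le_suminf sums_summable[OF S]) auto
  also have "\<dots> \<le> 10" using pi_squared_le_10 by (smt (verit) zero_le_divide_1_iff zero_le_power2)
  finally show ?thesis
    unfolding maj_def by (subst sum_divide_distrib[symmetric]) (rule divide_right_mono, auto)
qed

section \<open>Schur test and the remainder as an operator on l2\<close>

text \<open>A crude Schur test: interpolate between the \<open>\<ell>\<^sup>1\<close> and the supremum bound on the kernel.\<close>

lemma l2_le_kernel_sum:
  fixes a \<kappa> :: "nat \<Rightarrow> nat \<Rightarrow> real"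
  assumes a: "\<And>n k. \<bar>a n k\<bar> \<le> u n * \<kappa> n k" and u: "\<And>n. 0 \<le> u n" "summable u" "suminf u \<le> U"
    and \<kappa>: "\<And>n k. 0 \<le> \<kappa> n k" "\<And>n k. \<kappa> n k \<le> P" "\<And>n K. (\<Sum>k<K. \<kappa> n k) \<le> Q"
  shows "summable (\<lambda>n. a n k)" "l2_le (\<lambda>k. \<Sum>n. a n k) (U * sqrt (P * Q))"
proof -
  have P: "0 \<le> P" using \<kappa>(1,2) order_trans by blast
  have Q: "0 \<le> Q" using \<kappa>(3)[of _ 0] by simp
  have U: "0 \<le> U" using suminf_nonneg[OF u(2,1)] u(3) by linarith
  have su: "summable (\<lambda>n. u n * \<kappa> n k)" for k
  proof (rule summable_comparison_test')
    show "summable (\<lambda>n. u n * P)" by (rule summable_mult2[OF u(2)])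
    show "norm (u n * \<kappa> n k) \<le> u n * P" for n
      using u(1) \<kappa>(1,2) by (simp add: mult_left_mono)
  qed
  show sa: "summable (\<lambda>n. a n k)" for k
    by (rule summable_comparison_test'[OF su[of k]]) (simp add: a)
  \<comment> \<open>The majorant of the column sums has supremum at most \<open>U * P\<close> and
    total at most \<open>U * Q\<close>; the product of the two bounds its sum of squares.\<close>
  define \<rho> where "\<rho> k = (\<Sum>n. u n * \<kappa> n k)" for k
  have \<rho>0: "0 \<le> \<rho> k" for k
    unfolding \<rho>_def by (intro suminf_nonneg su mult_nonneg_nonneg u \<kappa>)
  have \<rho>P: "\<rho> k \<le> U * P" for k
  proof -
    have "\<rho> k \<le> (\<Sum>n. u n * P)"
      unfolding \<rho>_def by (intro suminf_le su summable_mult2 u mult_left_mono \<kappa>)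
    also have "\<dots> = suminf u * P" by (rule suminf_mult2[symmetric]) (rule u)
    also have "\<dots> \<le> U * P" by (intro mult_right_mono u P)
    finally show ?thesis .
  qed
  have \<rho>Q: "(\<Sum>k<K. \<rho> k) \<le> U * Q" for K
  proof -
    have "(\<Sum>k<K. \<rho> k) = (\<Sum>n. \<Sum>k<K. u n * \<kappa> n k)"
      unfolding \<rho>_def by (rule suminf_sum[symmetric]) (rule su)
    also have "\<dots> = (\<Sum>n. u n * (\<Sum>k<K. \<kappa> n k))" by (simp add: sum_distrib_left)
    also have "\<dots> \<le> (\<Sum>n. u n * Q)"
    proof (intro suminf_le mult_left_mono \<kappa> u summable_mult2)
      show "summable (\<lambda>n. u n * (\<Sum>k<K. \<kappa> n k))"
        unfolding sum_distrib_left by (intro summable_sum su)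
    qed
    also have "\<dots> = suminf u * Q" by (rule suminf_mult2[symmetric]) (rule u)
    also have "\<dots> \<le> U * Q" by (intro mult_right_mono u Q)
    finally show ?thesis .
  qed
  have "(\<Sum>k<K. (\<Sum>n. a n k)\<^sup>2) \<le> (U * sqrt (P * Q))\<^sup>2" for K
  proof -
    have "(\<Sum>k<K. (\<Sum>n. a n k)\<^sup>2) \<le> (\<Sum>k<K. U * P * \<rho> k)"
    proof (rule sum_mono)
      fix k
      have s: "summable (\<lambda>n. \<bar>a n k\<bar>)" by (rule summable_comparison_test'[OF su[of k]]) (simp add: a)
      have "\<bar>\<Sum>n. a n k\<bar> \<le> (\<Sum>n. \<bar>a n k\<bar>)" by (rule summable_rabs[OF s])
      also have "\<dots> \<le> \<rho> k" unfolding \<rho>_def by (intro suminf_le s su a)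
      finally have "(\<Sum>n. a n k)\<^sup>2 \<le> (\<rho> k)\<^sup>2" by (metis abs_ge_zero power2_abs power_mono)
      also have "\<dots> \<le> U * P * \<rho> k"
        unfolding power2_eq_square by (rule mult_right_mono[OF \<rho>P \<rho>0])
      finally show "(\<Sum>n. a n k)\<^sup>2 \<le> U * P * \<rho> k" .
    qed
    also have "\<dots> = U * P * (\<Sum>k<K. \<rho> k)" by (simp add: sum_distrib_left)
    also have "\<dots> \<le> U * P * (U * Q)"
      by (intro mult_left_mono \<rho>Q mult_nonneg_nonneg U P)
    also have "\<dots> = (U * sqrt (P * Q))\<^sup>2"
      using P Q by (simp add: power_mult_distrib power2_eq_square mult_ac)
    finally show ?thesis .
  qed
  then show "l2_le (\<lambda>k. \<Sum>n. a n k) (U * sqrt (P * Q))"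
    using U P Q by (simp add: l2_le_iff_sum_sq)
qed

definition rem_op :: "(nat \<Rightarrow> real) \<Rightarrow> nat \<Rightarrow> real" where
  "rem_op \<delta> k = (\<Sum>n. remainder (Suc k) (real n + 3/2) (\<delta> n))"

lemma schur_const_le: "sqrt (4.16 / 0.74 * (10 / 0.74)) \<le> 8.72"
  by (rule real_le_lsqrt) (simp_all add: power2_eq_square)

lemma remainder_diff_sum_bound:
  assumes "l2_le \<delta> 0.13" "l2_le \<epsilon> 0.13"
    and "summable (\<lambda>n. \<bar>\<delta> n - \<epsilon> n\<bar> * (\<bar>\<delta> n\<bar> + \<bar>\<epsilon> n\<bar>) / 2)"
    and "(\<Sum>n. \<bar>\<delta> n - \<epsilon> n\<bar> * (\<bar>\<delta> n\<bar> + \<bar>\<epsilon> n\<bar>) / 2) \<le> U"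
  shows "summable (\<lambda>n. remainder (Suc k) (real n + 3/2) (\<delta> n) - remainder (Suc k) (real n + 3/2) (\<epsilon> n))"
    and "l2_le (\<lambda>k. \<Sum>n. remainder (Suc k) (real n + 3/2) (\<delta> n) - remainder (Suc k) (real n + 3/2) (\<epsilon> n)) (8.72 * U)"
proof -
  let ?a = "\<lambda>n k. remainder (Suc k) (real n + 3/2) (\<delta> n) - remainder (Suc k) (real n + 3/2) (\<epsilon> n)"
  let ?u = "\<lambda>n. \<bar>\<delta> n - \<epsilon> n\<bar> * (\<bar>\<delta> n\<bar> + \<bar>\<epsilon> n\<bar>) / 2"
  have a: "\<bar>?a n k\<bar> \<le> ?u n * maj (Suc k) (real n + 3/2)" for n k
    by (intro remainder_lipschitz half_int_dist l2_le_component[OF assms(1)] l2_le_component[OF assms(2)])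
  have u0: "0 \<le> ?u n" for n by simp
  note K = l2_le_kernel_sum[OF a u0 assms(3,4) maj_nonneg maj_le sum_maj_le]
  show "summable (\<lambda>n. ?a n k)" by (rule K(1))
  have "0 \<le> U" using suminf_nonneg[OF assms(3) u0] assms(4) by linarith
  then have "U * sqrt (4.16 / 0.74 * (10 / 0.74)) \<le> 8.72 * U"
    using mult_left_mono[OF schur_const_le] by (simp add: mult.commute)
  from l2_le_mono[OF K(2) this] show "l2_le (\<lambda>k. \<Sum>n. ?a n k) (8.72 * U)" .
qed

lemma remainder_0 [simp]: "remainder k t 0 = 0"
  by (simp add: remainder_def ker_integral_def zero_ereal_def)

text \<open>Comparison with the zero sequence, where \<open>U = 0.13\<^sup>2 / 2\<close> and
  \<open>8.72 * U < 0.0737\<close>.\<close>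

lemma rem_op_bound:
  assumes "l2_le \<delta> 0.13"
  shows summable_remainder: "summable (\<lambda>n. remainder (Suc k) (real n + 3/2) (\<delta> n))"
    and l2_le_rem_op: "l2_le (rem_op \<delta>) 0.0737"
proof -
  have z: "l2_le (\<lambda>n. 0) 0.13" by (rule l2_le_mono[OF l2_le_zero]) simp
  have e: "\<bar>\<delta> n - 0\<bar> * (\<bar>\<delta> n\<bar> + \<bar>0\<bar>) / 2 = (\<delta> n)\<^sup>2 / 2" for n
    by (simp add: power2_eq_square)
  have s: "summable (\<lambda>n. \<bar>\<delta> n - 0\<bar> * (\<bar>\<delta> n\<bar> + \<bar>0\<bar>) / 2)"
    unfolding e by (intro summable_divide l2_le_summable_sq[OF assms])
  have "(\<Sum>n. \<bar>\<delta> n - 0\<bar> * (\<bar>\<delta> n\<bar> + \<bar>0\<bar>) / 2) \<le> 0.13\<^sup>2 / 2"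
    unfolding e using l2_le_summable_sq[OF assms] by (simp add: suminf_divide)
  note D = remainder_diff_sum_bound[OF assms z s this]
  show "summable (\<lambda>n. remainder (Suc k) (real n + 3/2) (\<delta> n))"
    using D(1) by simp
  show "l2_le (rem_op \<delta>) 0.0737"
    using l2_le_mono[OF D(2), of "0.0737"] by (simp add: rem_op_def[abs_def] power2_eq_square)
qed

text \<open>Cauchy-Schwarz with \<open>0.26\<close>, the sum of the two radii, gives
  \<open>U = 0.13 * c\<close>, and \<open>8.72 * 0.13 < 1.14\<close>.\<close>

lemma l2_le_rem_op_diff:
  assumes "l2_le \<delta> 0.13" "l2_le \<epsilon> 0.13" "l2_le (\<lambda>n. \<delta> n - \<epsilon> n) c"
  shows "l2_le (\<lambda>k. rem_op \<delta> k - rem_op \<epsilon> k) (1.14 * c)"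
proof -
  have abs: "l2_le (\<lambda>n. \<bar>f n\<bar>) a" if "l2_le f a" for f a
    using l2_le_dominated[OF that, of 1 "\<lambda>n. \<bar>f n\<bar>"] by simp
  have "l2_le (\<lambda>n. \<bar>\<delta> n\<bar> + \<bar>\<epsilon> n\<bar>) 0.26"
    using l2_le_add[OF abs abs, OF assms(1,2)] by simp
  note M = l2_le_mult[OF abs[OF assms(3)] this]
  have s: "summable (\<lambda>n. \<bar>\<delta> n - \<epsilon> n\<bar> * (\<bar>\<delta> n\<bar> + \<bar>\<epsilon> n\<bar>) / 2)"
    using summable_divide[OF M(1), of 2] by (simp add: abs_mult)
  have le: "(\<Sum>n. \<bar>\<delta> n - \<epsilon> n\<bar> * (\<bar>\<delta> n\<bar> + \<bar>\<epsilon> n\<bar>) / 2) \<le> 0.13 * c"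
    using M suminf_divide[OF M(1), of 2] by (simp add: abs_mult)
  have "(\<Sum>n. remainder (Suc k) (real n + 3/2) (\<delta> n) - remainder (Suc k) (real n + 3/2) (\<epsilon> n))
      = rem_op \<delta> k - rem_op \<epsilon> k" for k
    unfolding rem_op_def by (rule suminf_diff[symmetric]) (intro summable_remainder assms)+
  then have "l2_le (\<lambda>k. rem_op \<delta> k - rem_op \<epsilon> k) (8.72 * (0.13 * c))"
    using remainder_diff_sum_bound(2)[OF assms(1,2) s le] by simp
  then show ?thesis
    by (rule l2_le_mono) (use l2_le_nonneg[OF assms(3)] in simp)
qed

section \<open>The right-hand side\<close>

definition rhs :: "nat \<Rightarrow> real" where
  "rhs k = 1 / pi * (LBINT x=ereal (-1/2)..ereal (1/2). cos (pi * x) / (x - real k)\<^sup>2)"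

lemma has_integral_odd_zero:
  fixes f :: "real \<Rightarrow> real"
  assumes "(f has_integral i) {- a..a}" "\<And>x. f (- x) = - f x"
  shows "i = 0"
proof -
  have "((\<lambda>x. f (- x)) has_integral i) {- a..- (- a)}"
    using assms(1) by (subst has_integral_reflect_real) simp
  then have "((\<lambda>x. - f x) has_integral i) {- a..a}" by (simp add: assms(2))
  from has_integral_unique[OF this has_integral_neg[OF assms(1)]] show ?thesis by simp
qed

lemma has_integral_cos: "((\<lambda>x. cos (pi * x)) has_integral 2 / pi) {- (1/2)..1/2}"
proof -
  have "((\<lambda>x. cos (pi * x)) has_integral sin (pi * (1/2)) / pi - sin (pi * (- (1/2))) / pi) {- (1/2)..1/2}"
    by (rule fundamental_theorem_of_calculus)
      (auto intro!: derivative_eq_intros simp flip: has_real_derivative_iff_has_vector_derivative)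
  then show ?thesis by simp
qed

lemma has_integral_sq_cos:
  "((\<lambda>x. x\<^sup>2 * cos (pi * x)) has_integral 1 / (2 * pi) - 4 / pi ^ 3) {- (1/2)..1/2}"
proof -
  let ?F = "\<lambda>x. x\<^sup>2 * sin (pi * x) / pi + 2 * x * cos (pi * x) / pi\<^sup>2 - 2 * sin (pi * x) / pi ^ 3"
  have "((\<lambda>x. x\<^sup>2 * cos (pi * x)) has_integral ?F (1/2) - ?F (- (1/2))) {- (1/2)..1/2}"
  proof (rule fundamental_theorem_of_calculus)
    fix x :: real
    have "(?F has_real_derivative x\<^sup>2 * cos (pi * x)) (at x within {- (1/2)..1/2})"
      by (auto intro!: derivative_eq_intros simp: field_simps power2_eq_square power3_eq_cube)
    then show "(?F has_vector_derivative x\<^sup>2 * cos (pi * x)) (at x within {- (1/2)..1/2})"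
      by (simp only: has_real_derivative_iff_has_vector_derivative)
  qed simp
  then show ?thesis by (simp add: power2_eq_square)
qed

lemma has_integral_odd_cos:
  assumes "odd m" shows "((\<lambda>x. x ^ m * cos (pi * x)) has_integral 0) {- (1/2)..1/2}"
proof -
  have "(\<lambda>x. x ^ m * cos (pi * x)) integrable_on {- (1/2)..1/2}"
    by (intro integrable_continuous_real continuous_intros)
  then obtain i where i: "((\<lambda>x. x ^ m * cos (pi * x)) has_integral i) {- (1/2)..1/2}"
    by (auto simp: integrable_on_def)
  moreover have "i = 0"
    by (rule has_integral_odd_zero[OF i]) (use assms in simp)
  ultimately show ?thesis by simp
qed

text \<open>The cubic interpolates \<open>1 / (1 - z)\<^sup>2\<close> at \<open>z = 1/2\<close> and \<open>z = - 1/2\<close>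
  and agrees with it to first order at \<open>0\<close>.\<close>

lemma inverse_square_le_cubic:
  fixes z :: real
  assumes "\<bar>z\<bar> \<le> 1/2"
  shows "1 / (1 - z)\<^sup>2 \<le> 1 + 2 * z + 44/9 * z\<^sup>2 + 56/9 * z ^ 3"
proof -
  have "z\<^sup>2 \<le> (1/2)\<^sup>2" using assms by (metis abs_ge_zero power2_abs power_mono)
  \<comment> \<open>The difference after clearing the denominator, factored: a double zero at 0,
    simple zeros at \<open>1/2\<close> and \<open>- 1/2\<close>, and a factor
    \<open>17 - 14 * z\<close> that is positive here.\<close>
  then have "0 \<le> z\<^sup>2 * ((1 - 4 * z\<^sup>2) * (17 - 14 * z)) / 9"
    using assms by (intro divide_nonneg_nonneg mult_nonneg_nonneg) (auto simp: power2_eq_square)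
  also have "\<dots> = (1 + 2 * z + 44/9 * z\<^sup>2 + 56/9 * z ^ 3) * (1 - z)\<^sup>2 - 1"
    by (simp add: power2_eq_square power3_eq_cube algebra_simps add_divide_distrib diff_divide_distrib)
  finally have "1 \<le> (1 + 2 * z + 44/9 * z\<^sup>2 + 56/9 * z ^ 3) * (1 - z)\<^sup>2" by simp
  moreover have "0 < (1 - z)\<^sup>2" using assms by (simp add: abs_le_iff)
  ultimately show ?thesis by (simp add: pos_divide_le_eq)
qed

text \<open>The cubic majorant at \<open>z = x / k\<close> is integrated against the cosine. Odd
  moments vanish, leaving moments 0 and 2.\<close>

lemma rhs_bounds:
  assumes "k \<ge> 1"
  shows "0 \<le> rhs k" "rhs k \<le> 25 / 99 / (real k)\<^sup>2"
proof -
  let ?I = "{- (1/2)..1/2::real}"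
  let ?f = "\<lambda>x. cos (pi * x) / (x - real k)\<^sup>2"
  define a where "a = real k"
  have a: "1 \<le> a" using assms by (simp add: a_def)
  have cont: "continuous_on ?I ?f"
    using a by (intro continuous_intros) (auto simp: a_def)
  have int: "set_integrable lborel ?I ?f"
    by (rule borel_integrable_atLeastAtMost'[OF cont])
  have rhs: "rhs k = 1 / pi * integral ?I ?f"
    unfolding rhs_def using interval_integral_eq_integral[OF _ int] by simp
  have F: "(?f has_integral integral ?I ?f) ?I"
    by (intro integrable_integral integrable_continuous_real cont)
  have cos0: "0 \<le> cos (pi * x)" if "x \<in> ?I" for x
  proof -
    have "pi * x \<le> pi * (1/2)" "pi * (- (1/2)) \<le> pi * x"
      using that by (intro mult_left_mono; simp)+
    then show ?thesis by (intro cos_ge_zero) auto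
  qed
  have "0 \<le> integral ?I ?f"
    by (rule has_integral_nonneg[OF F]) (simp add: cos0)
  then show "0 \<le> rhs k" unfolding rhs by simp
  let ?g = "\<lambda>x. 1 / a\<^sup>2 * cos (pi * x) + 2 / a ^ 3 * (x ^ 1 * cos (pi * x)) +
      44 / 9 / a ^ 4 * (x\<^sup>2 * cos (pi * x)) + 56 / 9 / a ^ 5 * (x ^ 3 * cos (pi * x))"
  have G: "(?g has_integral 1 / a\<^sup>2 * (2 / pi) + 2 / a ^ 3 * 0 + 44 / 9 / a ^ 4 * (1 / (2 * pi) - 4 / pi ^ 3) + 56 / 9 / a ^ 5 * 0) ?I"
    by (intro has_integral_add has_integral_mult_right has_integral_cos has_integral_sq_cos has_integral_odd_cos) auto
  have "integral ?I ?f \<le> 1 / a\<^sup>2 * (2 / pi) + 2 / a ^ 3 * 0 + 44 / 9 / a ^ 4 * (1 / (2 * pi) - 4 / pi ^ 3) + 56 / 9 / a ^ 5 * 0"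
  proof (rule has_integral_le[OF F G])
    fix x assume x: "x \<in> ?I"
    have "\<bar>x\<bar> \<le> 1/2" using x by auto
    then have "\<bar>x / a\<bar> \<le> 1/2" using a by (simp add: divide_le_eq)
    have "?f x = cos (pi * x) * (1 / a\<^sup>2 * (1 / (1 - x / a)\<^sup>2))"
    proof -
      have "(x - real k)\<^sup>2 = a\<^sup>2 * (1 - x / a)\<^sup>2"
        using a by (simp add: a_def power2_eq_square field_simps)
      then show ?thesis by simp
    qed
    also have "\<dots> \<le> cos (pi * x) * (1 / a\<^sup>2 * (1 + 2 * (x / a) + 44/9 * (x / a)\<^sup>2 + 56/9 * (x / a) ^ 3))"
      by (intro mult_left_mono inverse_square_le_cubic cos0 x) (fact, simp)
    also have "\<dots> = ?g x"
      using a by (simp add: field_simps power2_eq_square eval_nat_numeral)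
    finally show "?f x \<le> ?g x" .
  qed
  also have "\<dots> \<le> 1 / a\<^sup>2 * (2 / pi + 44 / 9 * (1 / (2 * pi) - 4 / pi ^ 3))"
  proof -
    \<comment> \<open>The second moment is nonnegative as an integral, so its coefficient
      \<open>1 / a ^ 4\<close> may be raised to \<open>1 / a\<^sup>2\<close>.\<close>
    have m: "0 \<le> 1 / (2 * pi) - 4 / pi ^ 3"
      by (rule has_integral_nonneg[OF has_integral_sq_cos]) (simp add: cos0)
    have expand: "1 / a\<^sup>2 * (2 / pi) + 2 / a ^ 3 * 0 + 44 / 9 / a ^ 4 * M + 56 / 9 / a ^ 5 * 0
        \<le> 1 / a\<^sup>2 * (2 / pi + 44 / 9 * M)" if "1 / a ^ 4 * M \<le> 1 / a\<^sup>2 * M" for M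
      using that by (simp add: distrib_left)
    have "1 / a ^ 4 \<le> 1 / a\<^sup>2"
      using a by (intro divide_left_mono power_increasing) auto
    from mult_right_mono[OF this m] show ?thesis
      by (rule expand)
  qed
  finally have "rhs k \<le> 1 / pi * (1 / a\<^sup>2 * (2 / pi + 44 / 9 * (1 / (2 * pi) - 4 / pi ^ 3)))"
    unfolding rhs by (intro mult_left_mono) auto
  also have "\<dots> = (1 / pi * (2 / pi + 44 / 9 * (1 / (2 * pi) - 4 / pi ^ 3))) * (1 / a\<^sup>2)"
    by simp
  also have "\<dots> \<le> 25 / 99 * (1 / a\<^sup>2)"
  proof (rule mult_right_mono)
    \<comment> \<open>The constant is a quadratic polynomial in \<open>p\<close> with maximum
      \<open>25/99\<close> at \<open>p = 5/44\<close>, so no numerical estimate of \<open>pi\<close>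
      enters.\<close>
    define p where "p = 1 / pi\<^sup>2"
    have "1 / pi * (2 / pi + 44 / 9 * (1 / (2 * pi) - 4 / pi ^ 3)) = 40 / 9 * p - 176 / 9 * p\<^sup>2"
      by (simp add: p_def field_simps eval_nat_numeral)
    also have "\<dots> = 25 / 99 - 176 / 9 * (p - 5 / 44)\<^sup>2"
      by (simp add: power2_eq_square algebra_simps)
    also have "\<dots> \<le> 25 / 99" by simp
    finally show "1 / pi * (2 / pi + 44 / 9 * (1 / (2 * pi) - 4 / pi ^ 3)) \<le> 25 / 99" .
  qed simp
  finally show "rhs k \<le> 25 / 99 / (real k)\<^sup>2" by (simp add: a_def)
qed

text \<open>From the second term on, \<open>1 / x ^ 4\<close> is at most
  \<open>1 / (4 * x\<^sup>2 - 1)\<close>, which telescopes. The induction keeps the remaining tail;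
  its base case is the equality \<open>1 = 7/6 - 1/6\<close>.\<close>

lemma sum_inverse_fourth_powers_le: "(\<Sum>k<N. 1 / real (Suc k) ^ 4) \<le> 7 / 6"
proof -
  have "(\<Sum>k<Suc N. 1 / real (Suc k) ^ 4) \<le> 7 / 6 - 1 / (4 * real N + 6)" for N
  proof (induction N)
    case (Suc N)
    have "1 / real (Suc (Suc N)) ^ 4 \<le> 1 / (4 * real N + 6) - 1 / (4 * real (Suc N) + 6)"
    proof -
      define x where "x = real N + 2"
      have x: "2 \<le> x" by (simp add: x_def)
      then have "4 * x\<^sup>2 \<le> x\<^sup>2 * x\<^sup>2"
        by (intro mult_right_mono) (use power_mono[of 2 x 2] in auto)
      then have le: "4 * x\<^sup>2 - 1 \<le> x ^ 4" by (simp add: power4_eq_xxxx power2_eq_square mult.assoc)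
      have pos: "0 < 4 * x\<^sup>2 - 1" using power_mono[of 2 x 2] x by simp
      have "1 / (4 * x - 2) - 1 / (4 * x + 2) = 1 / (4 * x\<^sup>2 - 1)"
      proof -
        have canc: "4 / (4 * y) = 1 / y" for y :: real by simp
        have "1 / (4 * x - 2) - 1 / (4 * x + 2) = 4 / ((4 * x - 2) * (4 * x + 2))"
          using x by (subst diff_frac_eq) auto
        also have "(4 * x - 2) * (4 * x + 2) = 4 * (4 * x\<^sup>2 - 1)"
          by (simp add: power2_eq_square algebra_simps)
        finally show ?thesis unfolding canc .
      qed
      moreover have "1 / x ^ 4 \<le> 1 / (4 * x\<^sup>2 - 1)" using le pos by (simp add: frac_le)
      moreover have "real (Suc (Suc N)) = x" "4 * real N + 6 = 4 * x - 2" "4 * real (Suc N) + 6 = 4 * x + 2"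
        by (simp_all add: x_def)
      ultimately show ?thesis by (simp only:)
    qed
    with Suc show ?case by simp
  qed simp
  then have "(\<Sum>k<Suc N. 1 / real (Suc k) ^ 4) \<le> 7 / 6"
    by (rule order_trans) simp
  moreover have "(\<Sum>k<N. 1 / real (Suc k) ^ 4) \<le> (\<Sum>k<Suc N. 1 / real (Suc k) ^ 4)"
    by (intro sum_mono2) auto
  ultimately show ?thesis by linarith
qed

lemma l2_le_rhs: "l2_le (\<lambda>k. rhs (Suc k)) 0.273"
proof -
  have "(\<Sum>k<N. (rhs (Suc k))\<^sup>2) \<le> 0.273\<^sup>2" for N
  proof -
    have "(\<Sum>k<N. (rhs (Suc k))\<^sup>2) \<le> (\<Sum>k<N. (25 / 99)\<^sup>2 * (1 / real (Suc k) ^ 4))"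
    proof (rule sum_mono)
      fix k
      have "(rhs (Suc k))\<^sup>2 \<le> (25 / 99 / (real (Suc k))\<^sup>2)\<^sup>2"
        by (intro power_mono rhs_bounds) auto
      also have "\<dots> = (25 / 99)\<^sup>2 * (1 / real (Suc k) ^ 4)"
        by (simp only: power_divide flip: power_mult) simp
      finally show "(rhs (Suc k))\<^sup>2 \<le> (25 / 99)\<^sup>2 * (1 / real (Suc k) ^ 4)" .
    qed
    also have "\<dots> = (25 / 99)\<^sup>2 * (\<Sum>k<N. 1 / real (Suc k) ^ 4)"
      by (simp only: sum_distrib_left)
    also have "\<dots> \<le> (25 / 99)\<^sup>2 * (7 / 6)"
      by (intro mult_left_mono sum_inverse_fourth_powers_le) simp
    also have "\<dots> \<le> 0.273\<^sup>2" by (simp add: power2_eq_square)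
    finally show ?thesis .
  qed
  then show ?thesis by (simp add: l2_le_iff_sum_sq)
qed

section \<open>The fixed point\<close>

definition fp_source :: "(nat \<Rightarrow> real) \<Rightarrow> nat \<Rightarrow> real" where
  "fp_source \<delta> k = rhs (Suc k) - rem_op \<delta> k"

definition fp_map :: "(nat \<Rightarrow> real) \<Rightarrow> nat \<Rightarrow> real" where
  "fp_map \<delta> n = arcsin_pi (inv_op (fp_source \<delta>) n)"

lemma l2_le_fp_source:
  assumes "l2_le \<delta> 0.13" shows "l2_le (fp_source \<delta>) 0.3467"
  using l2_le_diff[OF l2_le_rhs l2_le_rem_op[OF assms]] by (simp add: fp_source_def[abs_def])

text \<open>\<open>0.3467 = 0.273 + 0.0737\<close>, and dividing by \<open>sqrt 8\<close> just stays
  within the range \<open>1/8\<close> in which the \<open>arcsin_pi\<close> estimates hold.\<close>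

lemma l2_le_inv_op_fp_source:
  assumes "l2_le \<delta> 0.13" shows "l2_le (inv_op (fp_source \<delta>)) (1/8)"
proof -
  have "0.3467 * 8 \<le> sqrt 8" by (rule real_le_rsqrt) (simp add: power2_eq_square)
  then have "0.3467 / sqrt 8 \<le> (1/8)" by (simp add: field_simps)
  then show ?thesis by (rule l2_le_mono[OF l2_le_inv_op[OF l2_le_fp_source[OF assms]]])
qed

text \<open>The radius is reproduced exactly: \<open>1.04 / 8 = 0.13\<close>.\<close>

lemma fp_map_self:
  assumes "l2_le \<delta> 0.13" shows "l2_le (fp_map \<delta>) 0.13"
proof -
  note b = l2_le_inv_op_fp_source[OF assms]
  have "l2_le (fp_map \<delta>) (1.04 * (1/8))"
    by (rule l2_le_dominated[OF b])
      (simp, unfold fp_map_def, rule arcsin_pi_bound[OF l2_le_component[OF b]])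
  then show ?thesis by simp
qed

lemma fp_map_contraction:
  assumes "l2_le \<delta> 0.13" "l2_le \<epsilon> 0.13" "l2_le (\<lambda>n. \<delta> n - \<epsilon> n) c"
  shows "l2_le (\<lambda>n. fp_map \<delta> n - fp_map \<epsilon> n) (c / 2)"
proof -
  have d: "l2_le (\<lambda>k. fp_source \<delta> k - fp_source \<epsilon> k) (1 * (1.14 * c))"
    by (rule l2_le_dominated[OF l2_le_rem_op_diff[OF assms]]) (auto simp: fp_source_def)
  have "l2_le (\<lambda>n. inv_op (fp_source \<delta>) n - inv_op (fp_source \<epsilon>) n) (1 * (1.14 * c) / sqrt 8)"
    using l2_le_inv_op[OF d] inv_op_diff[OF l2_le_fp_source[OF assms(1)] l2_le_fp_source[OF assms(2)]]
    by (simp add: l2_le_def cong: L2_set_cong)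
  then have "l2_le (\<lambda>n. fp_map \<delta> n - fp_map \<epsilon> n) (1.1 * (1 * (1.14 * c) / sqrt 8))"
    by (rule l2_le_dominated)
      (simp, unfold fp_map_def, intro arcsin_pi_lipschitz l2_le_component[OF l2_le_inv_op_fp_source] assms)
  moreover have "1.1 * (1 * (1.14 * c) / sqrt 8) \<le> c / 2"
  proof -
    have c: "0 \<le> c" by (rule l2_le_nonneg[OF assms(3)])
    \<comment> \<open>\<open>2.508 = 2 * 1.1 * 1.14\<close>, twice the product of the Lipschitz
      constants of \<open>arcsin_pi\<close> and of the remainder.\<close>
    have "2.508 \<le> sqrt 8" by (rule real_le_rsqrt) (simp add: power2_eq_square)
    then have "c * 2.508 \<le> c * sqrt 8" by (rule mult_left_mono[OF _ c])
    then show ?thesis by (simp add: field_simps)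
  qed
  ultimately show ?thesis by (rule l2_le_mono)
qed

text \<open>At a fixed point the sines equal the inverse applied to right-hand side minus remainder.
  Applying the matrix and adding the remainder back restores the integrals.\<close>

lemma ker_integral_sums_rhs:
  assumes "l2_le \<delta> 0.13" "fp_map \<delta> = \<delta>"
  shows "(\<lambda>n. ker_integral (Suc k) (real n + 3/2) (\<delta> n)) sums rhs (Suc k)"
proof -
  have s: "sin (pi * \<delta> n) / pi = inv_op (fp_source \<delta>) n" for n
    using sin_arcsin_pi[OF l2_le_component[OF l2_le_inv_op_fp_source[OF assms(1)]], of n]
    by (subst assms(2)[symmetric]) (simp add: fp_map_def)
  have "(\<lambda>n. remainder (Suc k) (real n + 3/2) (\<delta> n)) sums rem_op \<delta> k"
    unfolding rem_op_def by (rule summable_sums[OF summable_remainder[OF assms(1)]])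
  from sums_add[OF this sums_ker_mult_inv_op[OF l2_le_fp_source[OF assms(1)], of k]]
  have "(\<lambda>n. remainder (Suc k) (real n + 3/2) (\<delta> n) + ker (Suc k) (real n + 3/2) * (sin (pi * \<delta> n) / pi))
      sums (rem_op \<delta> k + fp_source \<delta> k)" unfolding s .
  then show ?thesis by (simp add: remainder_def fp_source_def)
qed

theorem theorem2:
  shows "\<exists>\<delta> :: nat \<Rightarrow> real. in_l2 \<delta> \<and> l2_norm \<delta> \<le> 0.13 \<and>
     (\<forall>k::nat. k \<ge> 1 \<longrightarrow>
        (\<lambda>n. LBINT y=ereal 0..ereal (\<delta> (Suc n)). cos (pi * y) *
               (1 / (real (Suc n) + 1/2 - y - real k) + 1 / (real (Suc n) + 1/2 - y + real k)))
        sums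
        (1 / pi * (LBINT x=ereal (-1/2)..ereal (1/2). cos (pi * x) / (x - real k)\<^sup>2)))"
proof -
  obtain x where x: "l2_le x 0.13" "fp_map x = x"
    using l2_contraction_fixpoint[of "0.13" fp_map, OF fp_map_self fp_map_contraction] by auto
  \<comment> \<open>Shifts the index by one; the value at 0, which is \<open>x 0\<close> by
    truncated subtraction, is ignored.\<close>
  define \<delta> where "\<delta> n = x (n - 1)" for n
  have \<delta>: "\<delta> (Suc n) = x n" for n by (simp add: \<delta>_def)
  have "in_l2 \<delta>"
    unfolding in_l2_def \<delta> by (rule l2_le_summable_sq[OF x(1)])
  moreover have "l2_norm \<delta> \<le> 0.13"
    unfolding l2_norm_def \<delta> using l2_le_summable_sq(2)[OF x(1)] by (intro real_le_lsqrt) auto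
  moreover have "(\<lambda>n. LBINT y=ereal 0..ereal (\<delta> (Suc n)). cos (pi * y) *
               (1 / (real (Suc n) + 1/2 - y - real k) + 1 / (real (Suc n) + 1/2 - y + real k)))
        sums (1 / pi * (LBINT x=ereal (-1/2)..ereal (1/2). cos (pi * x) / (x - real k)\<^sup>2))"
    if k1: "k \<ge> 1" for k
  proof -
    obtain j where k: "k = Suc j" using k1 by (cases k) auto
    have t: "real n + 3/2 = real (Suc n) + 1/2" for n by simp
    show ?thesis
      using ker_integral_sums_rhs[OF x, of j] unfolding ker_integral_def rhs_def ker_def t \<delta> k .
  qed
  ultimately show ?thesis by blast
qed

end
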